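(* Let $G=\langle r_0,\dots,r_{n-1}\rangle$ be a crystallographic linear Coxeter group with string diagram, and suppose the prime $p$ is generic for $G$. Let $V$, $V_0$, $V_{n-1}$ be non-singular, let $V_{0,n-1}$ be singular, and let $G_0^p$, $G_{n-1}^p$ be of orthogonal type. Suppose there is a square among the labels of the nodes $1,\dots,n-2$ of the diagram $\Delta(G)$. (a) Then $G_0^p\cap G_{n-1}^p$ acts trivially on $V_{0,n-1}^\perp$, and $$\widehat O_1(V_{0,n-1})\le G_0^p\cap G_{n-1}^p\le\widehat O(V_{0,n-1}),$$ where $\widehat O(V_{0,n-1})$ has been identified (via restriction to $V_{0,n-1}$) with the pointwise stabilizer of $V_{0,n-1}^\perp$ in $O(V)$, and $\widehat O_1(V_{0,n-1})$ with the subgroup of $O_1(V)$ generated by the reflections with roots in $V_{0,n-1}$ and square spinor norm. (b) If $G_0^p=O(V_0)$ and $G_{n-1}^p=O(V_{n-1})$ (with $O(V_0)$, $O(V_{n-1})$ interpreted as the pointwise stabilizers in $O(V)$ of $V_0^\perp$, $V_{n-1}^\perp$), then also $$\widehat O(V_{0,n-1})=G_0^p\cap G_{n-1}^p.$$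
   Context: Setting. $G=\langle r_0,\dots,r_{n-1}\rangle=[p_1,\dots,p_{n-1}]$ denotes a crystallographic Coxeter group with string Coxeter diagram (nodes $0,\dots,n-1$; the branch joining nodes $i-1$ and $i$ is marked $p_i$; $p_i=2$ means no branch), so each $p_i\in\{2,3,4,6,\infty\}$, in its standard representation as a reflection group on real $n$-space. A basic system is a basis $b_0,\dots,b_{n-1}$ of suitably rescaled simple roots: $b_i\cdot b_i>0$, $b_{i-1}\cdot b_i=-\cos(\pi/p_i)\sqrt{(b_{i-1}\cdot b_{i-1})(b_i\cdot b_i)}$ (with $\cos(\pi/\infty)=1$), $b_i\cdot b_j=0$ for $|i-j|\ge2$, $r_i(x)=x-2\frac{x\cdot b_i}{b_i\cdot b_i}b_i$, and all numbers $2\frac{b_i\cdot b_j}{b_i\cdot b_i}$ are integers. The diagram $\Delta(G)$ is the Coxeter diagram with node $i$ labelled $b_i^2:=b_i\cdot b_i$; the scaling is chosen so that the labels are positive integers with no prime divisors other than $2$ and $3$, and without the prime divisor $3$ on connected components having no branch marked $6$. (Labels may be readjusted by rescaling so that a square occurs among given nodes.) Labels are read modulo $p$, and "square" means square in $\mathbb Z_p=\mathbb Z/p\mathbb Z$. Reduction. For an odd prime $p$, reduce the matrices of the $r_i$ in the basis $(b_i)$ and the Gram matrix $[b_i\cdot b_j]$ modulo $p$. Now $V=\mathbb Z_p^n$ with standard basis $b_0,\dots,b_{n-1}$ and the (possibly singular) symmetric bilinear form $x\cdot y$ given by the reduced Gram matrix; $G^p\le O(V)$ is generated by the reduced $r_i$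 (again denoted $r_i$). The prime $p$ is generic for $G$ if $p\ge5$, or $p=3$ and no branch is marked $6$. For $J\subseteq\{0,\dots,n-1\}$, $G_J^p=\langle r_j\mid j\notin J\rangle$ and $V_J=\mathrm{span}\{b_j\mid j\notin J\}$; $G_0^p$, $V_{0,n-1}$, etc. abbreviate $J=\{0\}$, $J=\{0,n-1\}$, etc. Orthogonal groups. $O(W)$ is the isometry group of a space $W$ with symmetric bilinear form; $W$ is non-singular if $\mathrm{rad}\,W=W\cap W^\perp$ (the radical of $W$) is $\{0\}$, and singular otherwise. For non-isotropic $a$, $r_a(x)=x-2\frac{x\cdot a}{a\cdot a}a$ is the reflection with root $a$; its spinor norm is the class of $a\cdot a$ modulo squares. $O_1(W)$ (resp. $O_2(W)$) is the subgroup of $O(W)$ generated by the reflections $r_a$ with $a\cdot a$ a nonzero square (resp. a non-square). For possibly singular $W$, $\widehat O(W)$ is the subgroup of $O(W)$ of isometries acting trivially on $\mathrm{rad}\,W$, and $\widehat O_1(W)$ is the subgroup of $\widehat O(W)$ generated by the reflections $r_a$, $a\in W$, with $a\cdot a$ a nonzero square. For non-singular $W$ of dimension $m$ over $\mathbb Z_p$ one writes $O(m,p,\epsilon)=O(W)$, $O_j(m,p,\epsilon)=O_j(W)$, where $\epsilon=0$ if $m$ is odd, and for $m$ even $\epsilon=1$ or $-1$ according as the Witt index of $W$ is $m/2$ or not. Orthogonal type. $G_j^p$ ($j=0,n-1$), viewed as a group acting on $W=V_j$ (the restriction is faithful here), is of orthogonal type if it equals $O(W)$, $O_1(W)$ or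 $O_2(W)$, excluding the cases $O_1(3,3,0)$, $O_2(3,5,0)$, $O_2(5,3,0)$ (for these three the form is supposed normalized so that the discriminant of $W$ is a square) and excluding $O_j(4,3,-1)$. *)

theory Defs
  imports
    Complex_Main
    "HOL-Library.Extended_Nat"
    "HOL-Library.Function_Algebras"
    "HOL-Computational_Algebra.Nth_Powers"
    "HOL-Algebra.Bij"
    "HOL-Algebra.Generated_Groups"
    "Jordan_Normal_Form.Determinant"
    "Berlekamp_Zassenhaus.Finite_Field"
begin

section \<open>Coordinate spaces\<close>

text \<open>
  The space of \<open>n\<close>-tuples over a field \<open>'k\<close> is the subspace \<open>coord_space n\<close> of the functions
  \<^typ>\<open>nat \<Rightarrow> 'k\<close>, consisting of those functions that vanish at all indices \<open>\<ge> n\<close>.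
  Span, subspaces and dimension are those of the library theory of vector spaces.
\<close>

definition scl :: "'k::field \<Rightarrow> (nat \<Rightarrow> 'k) \<Rightarrow> nat \<Rightarrow> 'k" where
  "scl c x = (\<lambda>i. c * x i)"

interpretation fv: vector_space "scl :: 'k::field \<Rightarrow> (nat \<Rightarrow> 'k) \<Rightarrow> nat \<Rightarrow> 'k"
  by unfold_locales (auto simp: scl_def fun_eq_iff algebra_simps)

definition coord_space :: "nat \<Rightarrow> (nat \<Rightarrow> 'k::field) set" where
  "coord_space n = {x. \<forall>i\<ge>n. x i = 0}"

definition std_basis :: "nat \<Rightarrow> nat \<Rightarrow> 'k::field" where
  "std_basis i = (\<lambda>k. if k = i then 1 else 0)"

definition gram_form :: "nat \<Rightarrow> (nat \<Rightarrow> nat \<Rightarrow> 'k::field) \<Rightarrow> (nat \<Rightarrow> 'k) \<Rightarrow> (nat \<Rightarrow> 'k) \<Rightarrow> 'k" where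
  "gram_form n g x y = (\<Sum>i<n. \<Sum>j<n. x i * g i j * y j)"


section \<open>Orthogonal groups\<close>

type_synonym 'k form = "(nat \<Rightarrow> 'k) \<Rightarrow> (nat \<Rightarrow> 'k) \<Rightarrow> 'k"
type_synonym 'k trafo = "(nat \<Rightarrow> 'k) \<Rightarrow> nat \<Rightarrow> 'k"

text \<open>
  In this section \<open>B\<close> is a symmetric bilinear form and \<open>W\<close> is a finite-dimensional subspace.
  Transformations of \<open>W\<close> are elements of the library group \<open>BijGroup W\<close> of all permutations
  of \<open>W\<close>; in particular they are \<open>undefined\<close> outside \<open>W\<close>.
\<close>

definition perp :: "'k::field form \<Rightarrow> (nat \<Rightarrow> 'k) set \<Rightarrow> (nat \<Rightarrow> 'k) set \<Rightarrow> (nat \<Rightarrow> 'k) set" where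
  "perp B V W = {x \<in> V. \<forall>y\<in>W. B x y = 0}"

definition rad :: "'k::field form \<Rightarrow> (nat \<Rightarrow> 'k) set \<Rightarrow> (nat \<Rightarrow> 'k) set" where
  "rad B W = perp B W W"

definition nonsingular :: "'k::field form \<Rightarrow> (nat \<Rightarrow> 'k) set \<Rightarrow> bool" where
  "nonsingular B W \<longleftrightarrow> rad B W = {0}"

definition orth_group :: "'k::field form \<Rightarrow> (nat \<Rightarrow> 'k) set \<Rightarrow> 'k trafo set" where
  "orth_group B W = {f \<in> Bij W.
     (\<forall>x\<in>W. \<forall>y\<in>W. f (x + y) = f x + f y) \<and>
     (\<forall>c. \<forall>x\<in>W. f (scl c x) = scl c (f x)) \<and>
     (\<forall>x\<in>W. \<forall>y\<in>W. B (f x) (f y) = B x y)}"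

definition reflection :: "'k::field form \<Rightarrow> (nat \<Rightarrow> 'k) set \<Rightarrow> (nat \<Rightarrow> 'k) \<Rightarrow> 'k trafo" where
  "reflection B W a = (\<lambda>x\<in>W. x - scl (2 * B x a / B a a) a)"

text \<open>
  The groups generated by the reflections of \<open>V\<close> whose roots lie in \<open>W\<close> and have
  nonzero square norm, respectively non-square norm.  (Note that \<open>0\<close> satisfies \<open>is_square\<close>.)
\<close>

definition square_refl_group ::
  "'k::field form \<Rightarrow> (nat \<Rightarrow> 'k) set \<Rightarrow> (nat \<Rightarrow> 'k) set \<Rightarrow> 'k trafo set" where
  "square_refl_group B V W =
     generate (BijGroup V) {reflection B V a | a. a \<in> W \<and> B a a \<noteq> 0 \<and> is_square (B a a)}"

definition nonsquare_refl_group ::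
  "'k::field form \<Rightarrow> (nat \<Rightarrow> 'k) set \<Rightarrow> (nat \<Rightarrow> 'k) set \<Rightarrow> 'k trafo set" where
  "nonsquare_refl_group B V W =
     generate (BijGroup V) {reflection B V a | a. a \<in> W \<and> \<not> is_square (B a a)}"

definition orth_group1 :: "'k::field form \<Rightarrow> (nat \<Rightarrow> 'k) set \<Rightarrow> 'k trafo set" where
  "orth_group1 B W = square_refl_group B W W"

definition orth_group2 :: "'k::field form \<Rightarrow> (nat \<Rightarrow> 'k) set \<Rightarrow> 'k trafo set" where
  "orth_group2 B W = nonsquare_refl_group B W W"

definition orth_group_hat :: "'k::field form \<Rightarrow> (nat \<Rightarrow> 'k) set \<Rightarrow> 'k trafo set" where
  "orth_group_hat B W = {f \<in> orth_group B W. \<forall>x\<in>rad B W. f x = x}"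

text \<open>
  Reflections with roots in \<open>W\<close> fix \<open>rad B W\<close> pointwise, so the following is
  a subgroup of \<open>orth_group_hat B W\<close>.
\<close>

definition orth_group_hat1 :: "'k::field form \<Rightarrow> (nat \<Rightarrow> 'k) set \<Rightarrow> 'k trafo set" where
  "orth_group_hat1 B W = square_refl_group B W W"

definition pointwise_stabilizer ::
  "'k::field form \<Rightarrow> (nat \<Rightarrow> 'k) set \<Rightarrow> (nat \<Rightarrow> 'k) set \<Rightarrow> 'k trafo set" where
  "pointwise_stabilizer B V U = {f \<in> orth_group B V. \<forall>x\<in>U. f x = x}"

definition restrict_group :: "(nat \<Rightarrow> 'k) set \<Rightarrow> 'k trafo set \<Rightarrow> 'k trafo set" where
  "restrict_group W H = (\<lambda>f. restrict f W) ` H"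


section \<open>Groups of orthogonal type\<close>

text \<open>
  The discriminant of a non-singular space is defined modulo nonzero squares, so whether it is
  a square does not depend on the choice of the basis \<open>vs\<close>.
\<close>

definition square_disc :: "'k::field form \<Rightarrow> (nat \<Rightarrow> 'k) set \<Rightarrow> bool" where
  "square_disc B W \<longleftrightarrow> (\<exists>vs. distinct vs \<and> fv.independent (set vs) \<and> fv.span (set vs) = W \<and>
     is_square (det (mat (length vs) (length vs) (\<lambda>(i, j). B (vs ! i) (vs ! j)))))"

definition witt_index :: "'k::field form \<Rightarrow> (nat \<Rightarrow> 'k) set \<Rightarrow> nat" where
  "witt_index B W =
     Max {fv.dim U | U. fv.subspace U \<and> U \<subseteq> W \<and> (\<forall>x\<in>U. \<forall>y\<in>U. B x y = 0)}"

definition epsilon :: "'k::field form \<Rightarrow> (nat \<Rightarrow> 'k) set \<Rightarrow> int" where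
  "epsilon B W =
     (if odd (fv.dim W) then 0 else if 2 * witt_index B W = fv.dim W then 1 else - 1)"

text \<open>
  The three exceptional groups in odd dimension refer to the form after normalization, i.e.
  after multiplication by a nonzero constant \<open>c\<close> making the discriminant a square.
  Multiplication of the form by a non-square interchanges \<open>orth_group1\<close> and \<open>orth_group2\<close>.
\<close>

definition orthogonal_type :: "'k::field form \<Rightarrow> (nat \<Rightarrow> 'k) set \<Rightarrow> 'k trafo set \<Rightarrow> bool" where
  "orthogonal_type B W H \<longleftrightarrow>
     (H = orth_group B W \<or> H = orth_group1 B W \<or> H = orth_group2 B W) \<and>
     \<not> (\<exists>c. c \<noteq> 0 \<and> square_disc (\<lambda>x y. c * B x y) W \<and>
         (fv.dim W = 3 \<and> CARD('k) = 3 \<and> H = orth_group1 (\<lambda>x y. c * B x y) W \<or>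
          fv.dim W = 3 \<and> CARD('k) = 5 \<and> H = orth_group2 (\<lambda>x y. c * B x y) W \<or>
          fv.dim W = 5 \<and> CARD('k) = 3 \<and> H = orth_group2 (\<lambda>x y. c * B x y) W)) \<and>
     \<not> (fv.dim W = 4 \<and> CARD('k) = 3 \<and> epsilon B W = - 1 \<and>
         (H = orth_group1 B W \<or> H = orth_group2 B W))"


section \<open>Crystallographic Coxeter groups with string diagram\<close>

text \<open>
  The group is given by its rank \<open>n\<close>, the marks \<open>m i\<close> (\<open>1 \<le> i < n\<close>) of the branches joining
  the nodes \<open>i - 1\<close> and \<open>i\<close>, and the real Gram matrix \<open>g\<close> of a basic system
  \<open>b\<^sub>0, \<dots>, b\<^sub>n\<^sub>-\<^sub>1\<close>.  Coordinates on the real space are taken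
  with respect to the basic system, so \<open>b\<^sub>i\<close> is \<open>std_basis i\<close> and the form is \<open>gram_form n g\<close>.
\<close>

definition branch_cos :: "enat \<Rightarrow> real" where
  "branch_cos p = (case p of enat k \<Rightarrow> cos (pi / real k) | \<infinity> \<Rightarrow> 1)"

definition basic_system :: "nat \<Rightarrow> (nat \<Rightarrow> enat) \<Rightarrow> (nat \<Rightarrow> nat \<Rightarrow> real) \<Rightarrow> bool" where
  "basic_system n m g \<longleftrightarrow>
     (\<forall>i\<in>{1..<n}. m i \<in> {2, 3, 4, 6, \<infinity>}) \<and>
     (\<forall>i<n. \<forall>j<n. g i j = g j i) \<and>
     (\<forall>i<n. g i i > 0) \<and>
     (\<forall>i\<in>{1..<n}. g (i - 1) i = - branch_cos (m i) * sqrt (g (i - 1) (i - 1) * g i i)) \<and>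
     (\<forall>i<n. \<forall>j<n. i + 2 \<le> j \<longrightarrow> g i j = 0) \<and>
     (\<forall>i<n. \<forall>j<n. 2 * g i j / g i i \<in> \<int>)"

definition same_component :: "(nat \<Rightarrow> enat) \<Rightarrow> nat \<Rightarrow> nat \<Rightarrow> bool" where
  "same_component m i j \<longleftrightarrow> (\<forall>k. min i j < k \<and> k \<le> max i j \<longrightarrow> m k \<noteq> 2)"

definition admissible_labels :: "nat \<Rightarrow> (nat \<Rightarrow> enat) \<Rightarrow> (nat \<Rightarrow> nat \<Rightarrow> real) \<Rightarrow> bool" where
  "admissible_labels n m g \<longleftrightarrow>
     (\<forall>i<n. \<exists>d::nat. d > 0 \<and> g i i = real d \<and>
        (\<forall>q. prime q \<and> q dvd d \<longrightarrow> q \<in> {2, 3}) \<and>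
        (3 dvd d \<longrightarrow> (\<exists>k\<in>{1..<n}. m k = 6 \<and> same_component m i k)))"

definition generic_prime :: "nat \<Rightarrow> (nat \<Rightarrow> enat) \<Rightarrow> nat \<Rightarrow> bool" where
  "generic_prime n m p \<longleftrightarrow> prime p \<and> (p \<ge> 5 \<or> p = 3 \<and> (\<forall>k\<in>{1..<n}. m k \<noteq> 6))"


section \<open>Reduction modulo an odd prime\<close>

definition reduced_label :: "(nat \<Rightarrow> nat \<Rightarrow> real) \<Rightarrow> nat \<Rightarrow> 'p::prime_card mod_ring" where
  "reduced_label g i = of_int \<lfloor>g i i\<rfloor>"

text \<open>
  The entries of the Gram matrix are half-integers,
  \<open>2 * g i j = (2 * g i j / g i i) * g i i\<close> being a product of integers.
\<close>

definition reduced_gram :: "(nat \<Rightarrow> nat \<Rightarrow> real) \<Rightarrow> nat \<Rightarrow> nat \<Rightarrow> 'p::prime_card mod_ring" where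
  "reduced_gram g i j = of_int \<lfloor>2 * g i j\<rfloor> / 2"

definition reduced_form :: "nat \<Rightarrow> (nat \<Rightarrow> nat \<Rightarrow> real) \<Rightarrow> 'p::prime_card mod_ring form" where
  "reduced_form n g = gram_form n (reduced_gram g)"

definition root_reflection_matrix ::
  "nat \<Rightarrow> (nat \<Rightarrow> nat \<Rightarrow> real) \<Rightarrow> nat \<Rightarrow> nat \<Rightarrow> nat \<Rightarrow> real" where
  "root_reflection_matrix n g i k j =
     reflection (gram_form n g) (coord_space n) (std_basis i) (std_basis j) k"

text \<open>For a basic system the entries of \<open>root_reflection_matrix n g i\<close> are integers.\<close>

definition reduced_reflection ::
  "nat \<Rightarrow> (nat \<Rightarrow> nat \<Rightarrow> real) \<Rightarrow> nat \<Rightarrow> 'p::prime_card mod_ring trafo" where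
  "reduced_reflection n g i =
     (\<lambda>x\<in>coord_space n. \<lambda>k. if k < n
        then \<Sum>j<n. of_int \<lfloor>root_reflection_matrix n g i k j\<rfloor> * x j else 0)"

text \<open>The group \<open>G\<^sub>J\<^sup>p\<close> and the space \<open>V\<^sub>J\<close>.\<close>

definition reduced_group ::
  "nat \<Rightarrow> (nat \<Rightarrow> nat \<Rightarrow> real) \<Rightarrow> nat set \<Rightarrow> 'p::prime_card mod_ring trafo set" where
  "reduced_group n g J =
     generate (BijGroup (coord_space n)) {reduced_reflection n g j | j. j < n \<and> j \<notin> J}"

definition reduced_space :: "nat \<Rightarrow> nat set \<Rightarrow> (nat \<Rightarrow> 'p::prime_card mod_ring) set" where
  "reduced_space n J = fv.span {std_basis j | j. j < n \<and> j \<notin> J}"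

end

theory Submission
  imports Defs
begin

text \<open>
  Because \<open>V\<close> is non-singular, its basis \<open>b\<^sub>0, \<dots>, b\<^sub>n\<^sub>-\<^sub>1\<close> has a dual basis. Write \<open>e\<close>, \<open>e'\<close> for the
  dual vectors of index \<open>0\<close> and \<open>n - 1\<close>. Then \<open>V\<^sub>0\<close>, \<open>V\<^sub>n\<^sub>-\<^sub>1\<close> are the hyperplanes orthogonal to
  \<open>e\<close>, \<open>e'\<close>, the intersection \<open>W = V\<^sub>0\<^sub>,\<^sub>n\<^sub>-\<^sub>1\<close> is the space orthogonal to both, and \<open>W\<^sup>\<bottom>\<close> is
  spanned by \<open>e\<close> and \<open>e'\<close>. Non-singularity of the two hyperplanes means that \<open>e\<close> and \<open>e'\<close> are
  non-isotropic, whereas \<open>W\<close> contains a nonzero vector \<open>r\<close> of \<open>W\<^sup>\<bottom>\<close>.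

  The generators of \<open>G\<^sub>0\<close> are reflections whose roots are orthogonal to \<open>e\<close>, so \<open>G\<^sub>0\<close> fixes \<open>e\<close>; in
  the same way \<open>G\<^sub>n\<^sub>-\<^sub>1\<close> fixes \<open>e'\<close>. Hence \<open>G\<^sub>0 \<inter> G\<^sub>n\<^sub>-\<^sub>1\<close> fixes \<open>W\<^sup>\<bottom>\<close> pointwise
  (\<open>fixes_perp_W\<close>), which is the upper bound in (a). Part (b) follows, since an isometry fixing
  \<open>W\<^sup>\<bottom>\<close> fixes both \<open>V\<^sub>0\<^sup>\<bottom>\<close> and \<open>V\<^sub>n\<^sub>-\<^sub>1\<^sup>\<bottom>\<close>.

  For the lower bound, the square label \<open>i\<close> supplies a reflection with square spinor norm which lies
  in \<open>G\<^sub>0\<close>, and whose root lies in \<open>V\<^sub>0\<close>. Each of \<open>O(V\<^sub>0)\<close>, \<open>O\<^sub>1(V\<^sub>0)\<close>, \<open>O\<^sub>2(V\<^sub>0)\<close> that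
  contains one such reflection contains all of them: for the first two groups this is clear, and
  \<open>O\<^sub>2(V\<^sub>0)\<close> is normal in \<open>O(V\<^sub>0)\<close>, under which all reflections with square spinor norm are
  conjugate (\<open>square_reflection_in_orthogonal_type\<close>). An isometry that fixes \<open>e\<close> is determined by
  its restriction to \<open>V\<^sub>0\<close>, so all reflections of \<open>V\<close> with root in \<open>W\<close> and square spinor norm
  belong to \<open>G\<^sub>0\<close>, and likewise to \<open>G\<^sub>n\<^sub>-\<^sub>1\<close> (\<open>square_refl_group_le\<close>).

  That restriction to \<open>W\<close> identifies the pointwise stabilizer of \<open>W\<^sup>\<bottom>\<close> with the isometries of
  \<open>W\<close> fixing \<open>rad W\<close> is an instance of Witt's theorem, proved here by hand: one has
  \<open>V = W \<oplus> \<langle>b\<^sub>n\<^sub>-\<^sub>1\<rangle> \<oplus> \<langle>e\<rangle>\<close>, the vector \<open>e\<close> has to be fixed, and the inner products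
  with \<open>W\<close> and \<open>e\<close> determine the image of \<open>b\<^sub>n\<^sub>-\<^sub>1\<close> up to a multiple of \<open>r\<close>, which is then
  determined by the norm (\<open>isometry_extends\<close>, \<open>isometry_extension_unique\<close>).
\<close>

section \<open>Isometries and reflections of a symmetric bilinear form\<close>

locale symmetric_form =
  fixes B :: "'k::field form"
  assumes add_left: "B (x + y) z = B x z + B y z"
    and scl_left: "B (scl c x) z = c * B x z"
    and sym: "B x y = B y x"
begin

lemma add_right: "B z (x + y) = B z x + B z y"
  by (metis add_left sym)

lemma scl_right: "B z (scl c x) = c * B z x"
  by (metis scl_left sym)

lemma zero_left [simp]: "B 0 x = 0"
  using scl_left[of 0 0 x] by (simp add: scl_def zero_fun_def)

lemma zero_right [simp]: "B x 0 = 0"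
  by (metis sym zero_left)

lemma diff_left: "B (x - y) z = B x z - B y z"
  using add_left[of "x - y" y z] by simp

lemma diff_right: "B z (x - y) = B z x - B z y"
  by (metis diff_left sym)

lemmas bilinear = add_left add_right diff_left diff_right scl_left scl_right

lemma orth_groupD:
  assumes "f \<in> orth_group B U"
  shows "f \<in> Bij U" "f \<in> extensional U" "bij_betw f U U"
    "x \<in> U \<Longrightarrow> f x \<in> U"
    "x \<in> U \<Longrightarrow> y \<in> U \<Longrightarrow> f (x + y) = f x + f y"
    "x \<in> U \<Longrightarrow> f (scl c x) = scl c (f x)"
    "x \<in> U \<Longrightarrow> y \<in> U \<Longrightarrow> B (f x) (f y) = B x y"
proof -
  show "f \<in> Bij U"
    using assms by (simp add: orth_group_def)
  then show "f \<in> extensional U" "bij_betw f U U" "x \<in> U \<Longrightarrow> f x \<in> U"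
    using bij_betwE by (auto simp: Bij_def)
qed (use assms in \<open>auto simp: orth_group_def\<close>)

lemma subgroup_pointwise_stabilizer:
  assumes U: "fv.subspace U" and X: "X \<subseteq> U"
  shows "subgroup (pointwise_stabilizer B U X) (BijGroup U)"
proof -
  interpret G: group "BijGroup U" by (rule group_BijGroup)
  show ?thesis
  proof
    show "pointwise_stabilizer B U X \<subseteq> carrier (BijGroup U)"
      by (auto simp: pointwise_stabilizer_def orth_group_def BijGroup_def)
  next
    fix f h assume f: "f \<in> pointwise_stabilizer B U X" and h: "h \<in> pointwise_stabilizer B U X"
    have fo: "f \<in> orth_group B U" and ho: "h \<in> orth_group B U"
      using f h by (auto simp: pointwise_stabilizer_def)
    note fD = orth_groupD[OF fo] and hD = orth_groupD[OF ho]
    have "f \<otimes>\<^bsub>BijGroup U\<^esub> h = compose U f h"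
      using fD(1) hD(1) by (simp add: BijGroup_def)
    moreover have "compose U f h \<in> Bij U"
      using fD(1) hD(1) by (rule compose_Bij)
    ultimately show "f \<otimes>\<^bsub>BijGroup U\<^esub> h \<in> pointwise_stabilizer B U X"
      using f h X fD(4-7) hD(4-7) fv.subspace_add[OF U] fv.subspace_scale[OF U]
      by (auto simp: pointwise_stabilizer_def orth_group_def compose_eq subset_iff)
  next
    show "\<one>\<^bsub>BijGroup U\<^esub> \<in> pointwise_stabilizer B U X"
      using X fv.subspace_add[OF U] fv.subspace_scale[OF U]
      by (auto simp: BijGroup_def pointwise_stabilizer_def orth_group_def id_Bij subset_iff)
  next
    fix f assume f: "f \<in> pointwise_stabilizer B U X"
    have fo: "f \<in> orth_group B U"
      using f by (auto simp: pointwise_stabilizer_def)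
    note fD = orth_groupD[OF fo]
    define h where "h = (\<lambda>x\<in>U. inv_into U f x)"
    have h: "h \<in> Bij U"
      unfolding h_def by (rule restrict_inv_into_Bij[OF fD(1)])
    have hU: "h x \<in> U" if "x \<in> U" for x
      using that Bij_imp_funcset[OF h] by auto
    have fh: "f (h x) = x" if "x \<in> U" for x
      using that fD(3) by (simp add: h_def bij_betw_inv_into_right)
    have hf: "h (f x) = x" if "x \<in> U" for x
      using that fD(3,4) by (auto simp: h_def bij_betw_inv_into_left)
    have "h (x + y) = h x + h y" if "x \<in> U" "y \<in> U" for x y
      using hf[of "h x + h y"] that hU fh fD(5) fv.subspace_add[OF U] by simp
    moreover have "h (scl c x) = scl c (h x)" if "x \<in> U" for c x
      using hf[of "scl c (h x)"] that hU fh fD(6) fv.subspace_scale[OF U] by simp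
    moreover have "B (h x) (h y) = B x y" if "x \<in> U" "y \<in> U" for x y
      using fD(7)[of "h x" "h y"] that hU fh by simp
    moreover have "h x = x" if "x \<in> X" for x
      using hf[of x] that X f by (auto simp: pointwise_stabilizer_def)
    ultimately have "h \<in> pointwise_stabilizer B U X"
      using h by (simp add: pointwise_stabilizer_def orth_group_def)
    then show "inv\<^bsub>BijGroup U\<^esub> f \<in> pointwise_stabilizer B U X"
      by (simp add: inv_BijGroup[OF fD(1)] h_def)
  qed
qed

lemma subgroup_orth_group:
  assumes "fv.subspace U"
  shows "subgroup (orth_group B U) (BijGroup U)"
  using subgroup_pointwise_stabilizer[OF assms, of "{}"] by (simp add: pointwise_stabilizer_def)

lemma obtain_inverse_isometry:
  assumes U: "fv.subspace U" and f: "f \<in> orth_group B U"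
  obtains h where "h \<in> orth_group B U" "\<And>x. x \<in> U \<Longrightarrow> h (f x) = x"
proof
  show "inv\<^bsub>BijGroup U\<^esub> f \<in> orth_group B U"
    using subgroup.m_inv_closed[OF subgroup_orth_group[OF U] f] .
  show "(inv\<^bsub>BijGroup U\<^esub> f) (f x) = x" if "x \<in> U" for x
    using that orth_groupD(1,3,4)[OF f] by (simp add: inv_BijGroup bij_betw_inv_into_left)
qed

lemma reflection_in_orth_group:
  assumes U: "fv.subspace U" and a: "a \<in> U"
  shows "reflection B U a \<in> orth_group B U"
proof -
  let ?r = "reflection B U a"
  have r: "?r x = x - scl (2 * B x a / B a a) a" if "x \<in> U" for x
    using that by (simp add: reflection_def)
  have rU: "?r x \<in> U" if "x \<in> U" for x
    using that a fv.subspace_diff[OF U] fv.subspace_scale[OF U] by (simp add: r)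
  have rr: "?r (?r x) = x" if "x \<in> U" for x
  proof -
    have "?r (?r x) = x - scl (2 * B x a / B a a) a
        - scl (2 * B (x - scl (2 * B x a / B a a) a) a / B a a) a"
      using that rU[OF that] by (simp add: r)
    also have "B (x - scl (2 * B x a / B a a) a) a = (if B a a = 0 then B x a else - B x a)"
      by (simp add: bilinear)
    also have "x - scl (2 * B x a / B a a) a - scl (2 * (if B a a = 0 then B x a else - B x a) / B a a) a = x"
      by (simp add: scl_def fun_eq_iff)
    finally show ?thesis .
  qed
  have "bij_betw ?r U U"
    by (rule bij_betw_byWitness[where f' = ?r]) (auto simp: rr rU)
  moreover have "?r (x + y) = ?r x + ?r y" if "x \<in> U" "y \<in> U" for x y
    using that fv.subspace_add[OF U]
    by (simp add: r) (simp add: scl_def fun_eq_iff bilinear add_divide_distrib algebra_simps)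
  moreover have "?r (scl c x) = scl c (?r x)" if "x \<in> U" for c x
  proof -
    have "?r (scl c x) = scl c x - scl (2 * B (scl c x) a / B a a) a"
      by (rule r) (rule fv.subspace_scale[OF U that])
    also have "2 * B (scl c x) a / B a a = c * (2 * B x a / B a a)"
      by (simp add: scl_left)
    also have "scl c x - scl (c * (2 * B x a / B a a)) a = scl c (?r x)"
      unfolding r[OF that] by (simp add: fv.scale_right_diff_distrib)
    finally show ?thesis .
  qed
  moreover have "B (?r x) (?r y) = B x y" if "x \<in> U" "y \<in> U" for x y
  proof -
    have "B (x - scl s a) (y - scl t a) = B x y - t * B x a - s * B y a + s * (t * B a a)" for s t
      by (simp add: bilinear sym[of a y] algebra_simps)
    then show ?thesis
      using that by (cases "B a a = 0") (simp_all add: r, simp add: field_simps)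
  qed
  ultimately show ?thesis
    by (simp add: orth_group_def Bij_def reflection_def)
qed

lemma reflection_fixes:
  "x \<in> U \<Longrightarrow> B x a = 0 \<Longrightarrow> reflection B U a x = x"
  by (simp add: reflection_def scl_def fun_eq_iff)

lemma reflection_in_pointwise_stabilizer:
  assumes "fv.subspace U" "a \<in> W" "W \<subseteq> U"
  shows "reflection B U a \<in> pointwise_stabilizer B U (perp B U W)"
  using assms reflection_in_orth_group[of U a]
  by (auto simp: pointwise_stabilizer_def perp_def intro!: reflection_fixes)

lemma restrict_reflection:
  "W \<subseteq> U \<Longrightarrow> restrict (reflection B U a) W = reflection B W a"
  by (auto simp: reflection_def restrict_def fun_eq_iff)

lemma reflection_scl:
  assumes "c \<noteq> 0"
  shows "reflection B U (scl c a) = reflection B U a"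
  using assms unfolding reflection_def by (intro restrict_ext) (simp add: bilinear)

lemma conj_reflection:
  assumes U: "fv.subspace U" and f: "f \<in> orth_group B U" and a: "a \<in> U"
  shows "f \<otimes>\<^bsub>BijGroup U\<^esub> reflection B U a \<otimes>\<^bsub>BijGroup U\<^esub> inv\<^bsub>BijGroup U\<^esub> f
    = reflection B U (f a)"
proof -
  interpret G: group "BijGroup U" by (rule group_BijGroup)
  note fD = orth_groupD[OF f]
  have fa: "f a \<in> U" by (rule fD(4)[OF a])
  note r = orth_groupD(1,4)[OF reflection_in_orth_group[OF U a]]
  note r' = orth_groupD(1,4)[OF reflection_in_orth_group[OF U fa]]
  have eq: "compose U f (reflection B U a) = compose U (reflection B U (f a)) f"
  proof
    fix x show "compose U f (reflection B U a) x = compose U (reflection B U (f a)) f x"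
    proof (cases "x \<in> U")
      case True
      have "x = (x - scl (2 * B x a / B a a) a) + scl (2 * B x a / B a a) a"
        by simp
      moreover have "x - scl (2 * B x a / B a a) a \<in> U" "scl (2 * B x a / B a a) a \<in> U"
        using True a fv.subspace_diff[OF U] fv.subspace_scale[OF U] by auto
      ultimately have "f x = f (x - scl (2 * B x a / B a a) a) + scl (2 * B x a / B a a) (f a)"
        using fD(5,6) a by metis
      then have "f (x - scl (2 * B x a / B a a) a) = f x - scl (2 * B x a / B a a) (f a)"
        by (simp add: eq_diff_eq)
      then show ?thesis
        using True a fD(4,7) by (simp add: compose_eq reflection_def)
    qed (simp add: compose_def)
  qed
  have carr: "f \<in> carrier (BijGroup U)" "reflection B U (f a) \<in> carrier (BijGroup U)"
    using fD(1) r'(1) by (auto simp: BijGroup_def)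
  have "f \<otimes>\<^bsub>BijGroup U\<^esub> reflection B U a = reflection B U (f a) \<otimes>\<^bsub>BijGroup U\<^esub> f"
    using eq fD(1) r(1) r'(1) by (simp add: BijGroup_def)
  then show ?thesis
    using carr by (simp add: G.m_assoc)
qed

text \<open>Conjugation by an isometry \<open>f\<close> sends \<open>r\<^sub>a\<close> to \<open>r\<^sub>f\<^sub>a\<close> and so permutes the generators.\<close>

lemma normal_orth_group2:
  assumes U: "fv.subspace U"
  shows "orth_group2 B U \<lhd> (BijGroup U)\<lparr>carrier := orth_group B U\<rparr>"
proof -
  let ?O = "(BijGroup U)\<lparr>carrier := orth_group B U\<rparr>"
  let ?S = "{reflection B U a |a. a \<in> U \<and> \<not> is_square (B a a)}"
  interpret G: group "BijGroup U" by (rule group_BijGroup)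
  interpret O: group ?O
    using subgroup_orth_group[OF U] by (rule G.subgroup_imp_group)
  have S: "?S \<subseteq> orth_group B U"
    using reflection_in_orth_group[OF U] by auto
  have "generate ?O ?S \<lhd> ?O"
  proof (rule O.normal_generateI)
    show "?S \<subseteq> carrier ?O" using S by simp
    fix h f assume "h \<in> ?S" and f: "f \<in> carrier ?O"
    then obtain a where h: "h = reflection B U a" and a: "a \<in> U" "\<not> is_square (B a a)" by auto
    from f have f: "f \<in> orth_group B U" by simp
    have "f \<otimes>\<^bsub>?O\<^esub> h \<otimes>\<^bsub>?O\<^esub> inv\<^bsub>?O\<^esub> f = reflection B U (f a)"
      using conj_reflection[OF U f a(1)] G.m_inv_consistent[OF subgroup_orth_group[OF U] f]
      by (simp add: h)
    moreover have "f a \<in> U" "B (f a) (f a) = B a a"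
      using orth_groupD(4,7)[OF f] a by auto
    ultimately show "f \<otimes>\<^bsub>?O\<^esub> h \<otimes>\<^bsub>?O\<^esub> inv\<^bsub>?O\<^esub> f \<in> ?S"
      using a(2) by (auto intro!: exI[of _ "f a"])
  qed
  then show ?thesis
    using G.generate_consistent[OF S subgroup_orth_group[OF U]]
    by (simp add: orth_group2_def nonsquare_refl_group_def)
qed

text \<open>
  The norms of \<open>b - a\<close> and \<open>b + a\<close> add up to four times the norm of \<open>b\<close>, so one of these
  vectors is the root of a reflection, which takes \<open>b\<close> to \<open>a\<close> or to \<open>- a\<close>.
\<close>

lemma isometry_between_equal_norms:
  assumes U: "fv.subspace U" and a: "a \<in> U" and b: "b \<in> U"
    and norm: "B a a = B b b" "B b b \<noteq> 0" and two: "(2::'k) \<noteq> 0"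
  obtains f where "f \<in> orth_group B U" "f b = a \<or> f b = scl (- 1) a"
proof -
  have sum: "B (b - a) (b - a) + B (b + a) (b + a) = 2 * 2 * B b b"
    by (simp add: bilinear norm sym[of a b] algebra_simps)
  show thesis
  proof (cases "B (b - a) (b - a) = 0")
    case False
    have "2 * B b (b - a) = B (b - a) (b - a)"
      by (simp add: bilinear norm sym[of a b] algebra_simps)
    then have "reflection B U (b - a) b = a"
      using b False by (simp add: reflection_def scl_def fun_eq_iff)
    then show thesis
      using that reflection_in_orth_group[OF U fv.subspace_diff[OF U b a]] by blast
  next
    case True
    then have nz: "B (b + a) (b + a) \<noteq> 0"
      using sum norm two by (metis add_0 mult_eq_0_iff)
    have "2 * B b (b + a) = B (b + a) (b + a)"
      by (simp add: bilinear norm sym[of a b] algebra_simps)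
    then have "reflection B U (b + a) b = scl (- 1) a"
      using b nz by (simp add: reflection_def scl_def fun_eq_iff)
    then show thesis
      using that reflection_in_orth_group[OF U fv.subspace_add[OF U b a]] by blast
  qed
qed

text \<open>
  A reflection depends only on the line of its root. As the quotient of the two norms is a square,
  the roots can be rescaled to have equal norms.
\<close>

lemma square_reflections_conjugate:
  assumes U: "fv.subspace U" and two: "(2::'k) \<noteq> 0"
    and a: "a \<in> U" "is_square (B a a)" "B a a \<noteq> 0"
    and b: "b \<in> U" "is_square (B b b)" "B b b \<noteq> 0"
  obtains f where "f \<in> orth_group B U" "reflection B U (f b) = reflection B U a"
proof -
  obtain s t where s: "B a a = s ^ 2" and t: "B b b = t ^ 2"
    using a(2) b(2) by (auto simp: is_nth_power_def)
  have nz: "s \<noteq> 0" "t \<noteq> 0" using a(3) b(3) s t by auto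
  have norm: "B (scl (t / s) a) (scl (t / s) a) = B b b"
    using nz by (simp add: bilinear s t power2_eq_square)
  obtain f where f: "f \<in> orth_group B U"
      and fb: "f b = scl (t / s) a \<or> f b = scl (- 1) (scl (t / s) a)"
    using isometry_between_equal_norms[OF U fv.subspace_scale[OF U a(1)] b(1) norm b(3) two] .
  have "reflection B U (f b) = reflection B U a"
    using fb nz reflection_scl[of "t / s" U a] reflection_scl[of "- 1" U "scl (t / s) a"] by auto
  with f show thesis by (rule that)
qed

text \<open>
  Only \<open>orth_group2\<close>, which is generated by the other class of reflections, needs an argument: being
  normal in \<open>orth_group\<close>, it contains with \<open>r\<^sub>b\<close> all conjugates of \<open>r\<^sub>b\<close>. The reflection \<open>r\<^sub>b\<close> will be
  that of a node with square label.
\<close>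

lemma square_reflection_in_orthogonal_type:
  assumes U: "fv.subspace U" and two: "(2::'k) \<noteq> 0"
    and H: "H = orth_group B U \<or> H = orth_group1 B U \<or> H = orth_group2 B U"
    and b: "b \<in> U" "is_square (B b b)" "B b b \<noteq> 0" "reflection B U b \<in> H"
    and a: "a \<in> U" "is_square (B a a)" "B a a \<noteq> 0"
  shows "reflection B U a \<in> H"
  using H
proof (elim disjE)
  assume "H = orth_group B U"
  then show ?thesis using reflection_in_orth_group[OF U a(1)] by simp
next
  assume "H = orth_group1 B U"
  then show ?thesis
    using a by (auto simp: orth_group1_def square_refl_group_def intro!: generate.incl)
next
  assume H: "H = orth_group2 B U"
  interpret G: group "BijGroup U" by (rule group_BijGroup)
  interpret N: normal H "(BijGroup U)\<lparr>carrier := orth_group B U\<rparr>"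
    using normal_orth_group2[OF U] by (simp add: H)
  obtain f where f: "f \<in> orth_group B U" "reflection B U (f b) = reflection B U a"
    using square_reflections_conjugate[OF U two a b(1-3)] .
  show ?thesis
    using N.inv_op_closed2[of f "reflection B U b"] f b(4) conj_reflection[OF U f(1) b(1)]
      G.m_inv_consistent[OF subgroup_orth_group[OF U] f(1)] by simp
qed

end


section \<open>Non-singular coordinate spaces\<close>

lemma subspace_coord_space: "fv.subspace (coord_space n)"
  by (auto simp: fv.subspace_def coord_space_def scl_def)

lemma finite_coord_space: "finite (coord_space n :: (nat \<Rightarrow> 'k::{field,finite}) set)"
proof -
  have "coord_space n = {x :: nat \<Rightarrow> 'k. \<forall>i. (i \<in> {..<n} \<longrightarrow> x i \<in> UNIV) \<and> (i \<notin> {..<n} \<longrightarrow> x i = 0)}"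
    by (auto simp: coord_space_def)
  then show ?thesis
    using finite_set_of_finite_funs[of "{..<n}" "UNIV :: 'k set" 0] by simp
qed

lemma std_basis_in_coord_space: "i < n \<Longrightarrow> std_basis i \<in> coord_space n"
  by (auto simp: std_basis_def coord_space_def)

lemma std_basis_apply: "std_basis i k = (if k = i then 1 else 0)"
  by (simp add: std_basis_def)

lemma sum_fun_apply: "(\<Sum>i\<in>I. f i) k = (\<Sum>i\<in>I. f i k)"
  by (induction I rule: infinite_finite_induct) auto

lemma coord_space_expansion:
  assumes "x \<in> coord_space n"
  shows "x = (\<Sum>i<n. scl (x i) (std_basis i))"
proof
  fix k
  have "scl (x i) (std_basis i) k = (if k = i then x i else 0)" for i
    by (simp add: scl_def std_basis_def)
  then have "(\<Sum>i<n. scl (x i) (std_basis i)) k = (if k < n then x k else 0)"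
    by (simp add: sum_fun_apply)
  then show "x k = (\<Sum>i<n. scl (x i) (std_basis i)) k"
    using assms by (auto simp: coord_space_def)
qed

lemma linear_functional_expansion:
  fixes F :: "(nat \<Rightarrow> 'k::field) \<Rightarrow> 'k"
  assumes add: "\<And>x y. x \<in> coord_space n \<Longrightarrow> y \<in> coord_space n \<Longrightarrow> F (x + y) = F x + F y"
    and scl: "\<And>c x. x \<in> coord_space n \<Longrightarrow> F (scl c x) = c * F x"
    and x: "x \<in> coord_space n"
  shows "F x = (\<Sum>i<n. x i * F (std_basis i))"
proof -
  have zero: "F 0 = 0"
    using scl[of 0 0] fv.subspace_0[OF subspace_coord_space, of n] by (simp add: scl_def fun_eq_iff zero_fun_def)
  have "F (\<Sum>i\<in>I. scl (x i) (std_basis i)) = (\<Sum>i\<in>I. x i * F (std_basis i))"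
    if "finite I" "I \<subseteq> {..<n}" for I
    using that
  proof (induction I rule: finite_induct)
    case (insert j I)
    have "(\<Sum>i\<in>I. scl (x i) (std_basis i)) \<in> coord_space n"
      using insert.prems
      by (intro fv.subspace_sum[OF subspace_coord_space] fv.subspace_scale[OF subspace_coord_space]
          std_basis_in_coord_space) auto
    moreover have j: "(std_basis j :: nat \<Rightarrow> 'k) \<in> coord_space n"
      using insert.prems by (simp add: std_basis_in_coord_space)
    ultimately have "F (\<Sum>i\<in>insert j I. scl (x i) (std_basis i))
        = x j * F (std_basis j) + F (\<Sum>i\<in>I. scl (x i) (std_basis i))"
      using insert.hyps by (simp add: add scl fv.subspace_scale[OF subspace_coord_space j])
    also have "\<dots> = (\<Sum>i\<in>insert j I. x i * F (std_basis i))"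
      using insert by simp
    finally show ?case .
  qed (simp add: zero)
  from this[of "{..<n}"] show ?thesis
    using coord_space_expansion[OF x] by simp
qed

locale nonsingular_space = symmetric_form B for B :: "'k::{field,finite} form" +
  fixes n :: nat
  assumes nonsing: "nonsingular B (coord_space n)"
begin

abbreviation "V \<equiv> coord_space n :: (nat \<Rightarrow> 'k) set"

lemmas V_closed = fv.subspace_add[OF subspace_coord_space] fv.subspace_diff[OF subspace_coord_space]
  fv.subspace_scale[OF subspace_coord_space]

lemma eq_zeroI:
  assumes "x \<in> V" "\<And>y. y \<in> V \<Longrightarrow> B x y = 0"
  shows "x = 0"
proof -
  have "x \<in> rad B V"
    using assms by (simp add: rad_def perp_def)
  then show ?thesis
    using nonsing by (simp add: nonsingular_def)
qed

text \<open>
  By non-singularity the coefficients \<open>B z b\<^sub>i\<close> determine \<open>z\<close>; an injective map of the finite set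
  \<open>V\<close> into itself is onto, so the coefficients can be prescribed.
\<close>

lemma representing_vector:
  assumes add: "\<And>x y. x \<in> V \<Longrightarrow> y \<in> V \<Longrightarrow> F (x + y) = F x + F y"
    and scl: "\<And>c x. x \<in> V \<Longrightarrow> F (scl c x) = c * F x"
  obtains z where "z \<in> V" "\<And>x. x \<in> V \<Longrightarrow> B z x = F x"
proof -
  define \<Phi> where "\<Phi> z = (\<lambda>i. if i < n then B z (std_basis i) else 0)" for z
  have expand: "B z x = (\<Sum>i<n. x i * B z (std_basis i))" if "x \<in> V" for z x
    using linear_functional_expansion[where F = "B z", OF _ _ that] by (simp add: bilinear)
  have "inj_on \<Phi> V"
  proof (rule inj_onI)
    fix x y assume xy: "x \<in> V" "y \<in> V" and eq: "\<Phi> x = \<Phi> y"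
    have "B x (std_basis i) = B y (std_basis i)" if "i < n" for i
      using fun_cong[OF eq, of i] that by (simp add: \<Phi>_def)
    then have eq': "B x v = B y v" if "v \<in> V" for v
      unfolding expand[OF that] by simp
    have "x - y = 0"
    proof (rule eq_zeroI)
      show "x - y \<in> V" by (rule V_closed(2)[OF xy])
      show "B (x - y) v = 0" if "v \<in> V" for v
        using eq'[OF that] by (simp add: diff_left)
    qed
    then show "x = y" by simp
  qed
  moreover have "\<Phi> ` V \<subseteq> V"
    by (auto simp: \<Phi>_def coord_space_def)
  ultimately have surj: "\<Phi> ` V = V"
    by (intro endo_inj_surj finite_coord_space)
  have "(\<lambda>i. if i < n then F (std_basis i) else 0) \<in> V"
    by (auto simp: coord_space_def)
  then have "(\<lambda>i. if i < n then F (std_basis i) else 0) \<in> \<Phi> ` V"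
    by (simp only: surj)
  then obtain z where z: "z \<in> V" and eq: "(\<lambda>i. if i < n then F (std_basis i) else 0) = \<Phi> z"
    by (rule imageE)
  have "B z (std_basis i) = F (std_basis i)" if "i < n" for i
    using fun_cong[OF eq, of i] that by (simp add: \<Phi>_def)
  note zF = this
  have "B z x = F x" if x: "x \<in> V" for x
  proof -
    have "F x = (\<Sum>i<n. x i * F (std_basis i))"
      using add scl x by (rule linear_functional_expansion)
    also have "\<dots> = B z x"
      unfolding expand[OF x] by (intro sum.cong refl) (simp add: zF)
    finally show ?thesis by simp
  qed
  with z show thesis by (rule that)
qed

text \<open>Preserving a non-singular form forces injectivity, hence bijectivity on the finite set \<open>V\<close>.\<close>

lemma isometryI:
  assumes ext: "f \<in> extensional V" and fV: "\<And>x. x \<in> V \<Longrightarrow> f x \<in> V"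
    and add: "\<And>x y. x \<in> V \<Longrightarrow> y \<in> V \<Longrightarrow> f (x + y) = f x + f y"
    and scl: "\<And>c x. x \<in> V \<Longrightarrow> f (scl c x) = scl c (f x)"
    and isom: "\<And>x y. x \<in> V \<Longrightarrow> y \<in> V \<Longrightarrow> B (f x) (f y) = B x y"
  shows "f \<in> orth_group B V"
proof -
  have "inj_on f V"
  proof (rule inj_onI)
    fix x y assume xy: "x \<in> V" "y \<in> V" and eq: "f x = f y"
    have "x - y = 0"
    proof (rule eq_zeroI)
      show "x - y \<in> V" by (rule V_closed(2)[OF xy])
      show "B (x - y) z = 0" if "z \<in> V" for z
        using isom[OF xy(1) that] isom[OF xy(2) that] eq by (simp add: diff_left)
    qed
    then show "x = y" by simp
  qed
  then have "f ` V = V"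
    using fV by (intro endo_inj_surj finite_coord_space) auto
  then show ?thesis
    using \<open>inj_on f V\<close> ext add scl isom by (simp add: orth_group_def Bij_def bij_betw_def)
qed

text \<open>
  Here \<open>V = U \<oplus> \<langle>e\<rangle>\<close> because \<open>e\<close> is non-isotropic. Hence an element of \<open>G\<close> with the same
  restriction to \<open>U\<close> as a reflection with root in \<open>U\<close> coincides with this reflection.
\<close>

lemma square_refl_group_le:
  assumes two: "(2::'k) \<noteq> 0" and e: "e \<in> V" "B e e \<noteq> 0"
    and U: "U = {x \<in> V. B x e = 0}"
    and G: "G \<subseteq> pointwise_stabilizer B V {e}" "subgroup G (BijGroup V)"
    and type: "orthogonal_type B U (restrict_group U G)"
    and b: "b \<in> U" "is_square (B b b)" "B b b \<noteq> 0" "reflection B V b \<in> G"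
    and W: "W \<subseteq> U"
  shows "square_refl_group B V W \<subseteq> G"
proof -
  have U': "fv.subspace U"
    by (auto simp: U fv.subspace_def V_closed fv.subspace_0[OF subspace_coord_space] bilinear)
  have UV: "U \<subseteq> V" by (auto simp: U)
  have H: "restrict_group U G = orth_group B U \<or> restrict_group U G = orth_group1 B U
      \<or> restrict_group U G = orth_group2 B U"
    using type unfolding orthogonal_type_def by (rule conjunct1)
  interpret Bij: group "BijGroup V" by (rule group_BijGroup)
  have "reflection B V a \<in> G" if a: "a \<in> W" "B a a \<noteq> 0" "is_square (B a a)" for a
  proof -
    have aU: "a \<in> U" using a W by auto
    have "reflection B U b \<in> restrict_group U G"
      using b(4) by (auto simp: restrict_group_def restrict_reflection[OF UV, symmetric])
    then have "reflection B U a \<in> restrict_group U G"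
      using square_reflection_in_orthogonal_type[OF U' two H b(1-3) _ aU a(3,2)] by simp
    then obtain f where f: "f \<in> G" and fr: "restrict f U = reflection B U a"
      by (auto simp: restrict_group_def)
    have fo: "f \<in> orth_group B V" and fe: "f e = e"
      using f G(1) by (auto simp: pointwise_stabilizer_def)
    have aV: "a \<in> V" using aU UV by auto
    have ro: "reflection B V a \<in> orth_group B V"
      by (rule reflection_in_orth_group[OF subspace_coord_space aV])
    have re: "reflection B V a e = e"
      using e aU by (intro reflection_fixes) (auto simp: U sym[of e a])
    have eq: "f x = reflection B V a x" if x: "x \<in> V" for x
    proof -
      define s where "s = B x e / B e e"
      have u: "x - scl s e \<in> U"
        using x e by (auto simp: U V_closed bilinear s_def)
      have "f (x - scl s e) = reflection B V a (x - scl s e)"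
        using fun_cong[OF fr, of "x - scl s e"] u UV by (auto simp: reflection_def)
      then have "f (x - scl s e) + f (scl s e)
          = reflection B V a (x - scl s e) + reflection B V a (scl s e)"
        using orth_groupD(6)[OF fo] orth_groupD(6)[OF ro] e fe re by simp
      then show ?thesis
        using orth_groupD(5)[OF fo, of "x - scl s e" "scl s e"]
          orth_groupD(5)[OF ro, of "x - scl s e" "scl s e"] x e by (simp add: V_closed)
    qed
    have "f = reflection B V a"
      by (rule extensionalityI[OF orth_groupD(2)[OF fo] orth_groupD(2)[OF ro] eq])
    with f show ?thesis by simp
  qed
  then show ?thesis
    unfolding square_refl_group_def using G(2) by (intro Bij.generate_subgroup_incl) auto
qed

end


section \<open>Intersections of two hyperplanes\<close>

text \<open>
  The hyperplanes are those orthogonal to \<open>e\<close> and \<open>e'\<close>. The vectors \<open>b\<close>, \<open>b'\<close>, dual to the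
  normal vectors, span a complement of the intersection of the hyperplanes, in which \<open>y\<close> has the
  coordinates \<open>y \<cdot> e\<close> and \<open>y \<cdot> e'\<close>.
\<close>

locale hyperplane_pair = nonsingular_space B n
  for B :: "'k::{field,finite} form" and n +
  fixes e e' b b' :: "nat \<Rightarrow> 'k"
  assumes V: "e \<in> coord_space n" "e' \<in> coord_space n" "b \<in> coord_space n" "b' \<in> coord_space n"
    and dual: "B b e = 1" "B b e' = 0" "B b' e = 0" "B b' e' = 1"
begin

definition W where "W = {x \<in> V. B x e = 0 \<and> B x e' = 0}"

lemma W_V: "x \<in> W \<Longrightarrow> x \<in> V" and W_e: "x \<in> W \<Longrightarrow> B x e = 0" and W_e': "x \<in> W \<Longrightarrow> B x e' = 0"
  by (auto simp: W_def)

lemma subspace_W: "fv.subspace W"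
  by (auto simp: W_def fv.subspace_def V_closed fv.subspace_0[OF subspace_coord_space] bilinear)

lemmas W_closed = fv.subspace_add[OF subspace_W] fv.subspace_diff[OF subspace_W]
  fv.subspace_scale[OF subspace_W]

text \<open>
  The projection \<open>y - (y \<cdot> e) b - (y \<cdot> e') b'\<close> lies in \<open>W\<close>. Therefore a vector \<open>x\<close> orthogonal
  to \<open>W\<close> has the same inner product with every \<open>y\<close> as \<open>(x \<cdot> b) e + (x \<cdot> b') e'\<close>.
\<close>

lemma perp_W_expansion:
  assumes x: "x \<in> V" and perp: "\<And>w. w \<in> W \<Longrightarrow> B x w = 0"
  shows "x = scl (B x b) e + scl (B x b') e'"
proof -
  have "x - (scl (B x b) e + scl (B x b') e') = 0"
  proof (rule eq_zeroI)
    fix y assume y: "y \<in> V"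
    have "y - scl (B y e) b - scl (B y e') b' \<in> W"
      using y V dual by (simp add: W_def V_closed bilinear)
    from perp[OF this]
    show "B (x - (scl (B x b) e + scl (B x b') e')) y = 0"
      by (simp add: bilinear sym[of e y] sym[of e' y] algebra_simps)
  qed (use x V in \<open>simp add: V_closed\<close>)
  then show ?thesis by simp
qed

lemma e_in_perp: "e \<in> perp B V W" and e'_in_perp: "e' \<in> perp B V W"
  using V by (auto simp: perp_def W_def sym[of e] sym[of e'])

lemma fixes_perp_W:
  assumes f: "f \<in> orth_group B V" and fe: "f e = e" "f e' = e'" and x: "x \<in> perp B V W"
  shows "f x = x"
proof -
  have "x = scl (B x b) e + scl (B x b') e'"
    using x by (intro perp_W_expansion) (auto simp: perp_def)
  then show ?thesis
    using fe orth_groupD(5)[OF f] orth_groupD(6)[OF f] V V_closed(3) by metis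
qed

lemma stabilizes_W:
  assumes f: "f \<in> pointwise_stabilizer B V (perp B V W)"
  shows "w \<in> W \<Longrightarrow> f w \<in> W" and "f ` W = W"
proof -
  have fo: "f \<in> orth_group B V" and fe: "f e = e" "f e' = e'"
    using f e_in_perp e'_in_perp by (auto simp: pointwise_stabilizer_def)
  show fW: "f w \<in> W" if "w \<in> W" for w
    using that orth_groupD(4)[OF fo, of w] orth_groupD(7)[OF fo, of w e]
      orth_groupD(7)[OF fo, of w e'] fe V by (auto simp: W_def)
  have "inj_on f W"
    using orth_groupD(3)[OF fo] by (auto simp: W_def bij_betw_def inj_on_def)
  moreover have "finite W"
    using finite_coord_space[of n] by (rule rev_finite_subset) (auto simp: W_def)
  ultimately show "f ` W = W"
    using fW by (intro endo_inj_surj) auto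
qed

abbreviation "stabW \<equiv> (BijGroup V)\<lparr>carrier := pointwise_stabilizer B V (perp B V W)\<rparr>"

lemma subgroup_stabW: "subgroup (pointwise_stabilizer B V (perp B V W)) (BijGroup V)"
  by (intro subgroup_pointwise_stabilizer subspace_coord_space) (auto simp: perp_def)

lemma restrict_in_orth_group_hat:
  assumes f: "f \<in> pointwise_stabilizer B V (perp B V W)"
  shows "restrict f W \<in> orth_group_hat B W"
proof -
  have fo: "f \<in> orth_group B V" using f by (simp add: pointwise_stabilizer_def)
  have "bij_betw f W W"
    using stabilizes_W(2)[OF f] orth_groupD(3)[OF fo]
    by (auto simp: bij_betw_def inj_on_def W_def)
  then have "restrict f W \<in> Bij W" by (simp add: Bij_def)
  moreover have "f x = x" if "x \<in> rad B W" for x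
    using that f by (auto simp: pointwise_stabilizer_def rad_def perp_def W_def)
  ultimately show ?thesis
    using orth_groupD(5-7)[OF fo] W_V W_closed
    by (auto simp: orth_group_hat_def orth_group_def rad_def perp_def)
qed

lemma restrict_compose:
  assumes f: "f \<in> pointwise_stabilizer B V (perp B V W)"
    and h: "h \<in> pointwise_stabilizer B V (perp B V W)"
  shows "restrict (f \<otimes>\<^bsub>BijGroup V\<^esub> h) W = restrict f W \<otimes>\<^bsub>BijGroup W\<^esub> restrict h W"
proof -
  have "f \<in> Bij V" "h \<in> Bij V" "restrict f W \<in> Bij W" "restrict h W \<in> Bij W"
    using f h restrict_in_orth_group_hat[OF f] restrict_in_orth_group_hat[OF h]
    by (auto simp: pointwise_stabilizer_def orth_group_hat_def orth_group_def)
  then show ?thesis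
    using stabilizes_W(1)[OF h] W_V by (auto simp: BijGroup_def compose_def fun_eq_iff)
qed

lemma group_hom_restrict: "group_hom stabW (BijGroup W) (\<lambda>f. restrict f W)"
proof (intro group_hom.intro group_hom_axioms.intro homI)
  show "group stabW"
    using group.subgroup_imp_group[OF group_BijGroup subgroup_stabW] .
qed (use restrict_in_orth_group_hat restrict_compose group_BijGroup in
    \<open>auto simp: orth_group_hat_def orth_group_def BijGroup_def\<close>)

lemma restrict_square_refl_group:
  "restrict_group W (square_refl_group B V W) = orth_group_hat1 B W"
proof -
  interpret Bij: group "BijGroup V" by (rule group_BijGroup)
  interpret R: group_hom stabW "BijGroup W" "\<lambda>f. restrict f W" by (rule group_hom_restrict)
  let ?S = "{reflection B V a | a. a \<in> W \<and> B a a \<noteq> 0 \<and> is_square (B a a)}"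
  have WV: "W \<subseteq> V" by (auto simp: W_def)
  have S: "?S \<subseteq> pointwise_stabilizer B V (perp B V W)"
    using reflection_in_pointwise_stabilizer[OF subspace_coord_space _ WV] by auto
  have "generate (BijGroup W) ((\<lambda>f. restrict f W) ` ?S) = (\<lambda>f. restrict f W) ` generate stabW ?S"
    by (rule R.generate_img) (use S in simp)
  moreover have "(\<lambda>f. restrict f W) ` ?S
      = {reflection B W a | a. a \<in> W \<and> B a a \<noteq> 0 \<and> is_square (B a a)}"
    unfolding restrict_reflection[OF WV, symmetric] by blast
  moreover have "generate stabW ?S = generate (BijGroup V) ?S"
    by (rule Bij.generate_consistent[OF S subgroup_stabW])
  ultimately show ?thesis
    by (simp add: restrict_group_def orth_group_hat1_def square_refl_group_def)
qed

lemma square_refl_group_le_pointwise_stabilizer: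
  "square_refl_group B V W \<subseteq> pointwise_stabilizer B V (perp B V W)"
proof -
  interpret Bij: group "BijGroup V" by (rule group_BijGroup)
  have "W \<subseteq> V" by (auto simp: W_def)
  then show ?thesis
    unfolding square_refl_group_def
    using reflection_in_pointwise_stabilizer[OF subspace_coord_space]
    by (intro Bij.generate_subgroup_incl subgroup_stabW) auto
qed

lemma square_refl_group_le_orth_group1:
  "square_refl_group B V W \<subseteq> orth_group1 B V"
  unfolding square_refl_group_def orth_group1_def
  using reflection_in_orth_group[OF subspace_coord_space, of _ n]
  by (intro group.mono_generate[OF group_BijGroup]) (auto simp: W_def)

end


section \<open>Extending isometries of a singular intersection\<close>

text \<open>
  With \<open>e\<close> non-isotropic and \<open>r\<close> a nonzero vector of \<open>rad W\<close>, the space \<open>W\<^sup>\<bottom>\<close> is spanned by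
  \<open>e\<close> and \<open>r\<close> (\<open>r_expansion\<close>, \<open>r_b'\<close>), and \<open>V\<close> is the direct sum of \<open>W\<close>, the line of
  \<open>b'\<close> and the line of \<open>e\<close>.
\<close>

locale singular_hyperplane_pair = hyperplane_pair B n e e' b b'
  for B :: "'k::{field,finite} form" and n e e' b b' +
  fixes r
  assumes two: "(2::'k) \<noteq> 0" and e_norm: "B e e \<noteq> 0"
    and r: "r \<in> rad B W" "r \<noteq> 0"
begin

lemma r_W: "r \<in> W" and r_perp: "w \<in> W \<Longrightarrow> B r w = 0"
  using r by (auto simp: rad_def perp_def)

lemma r_V: "r \<in> V"
  using r_W by (rule W_V)

lemma r_expansion: "r = scl (B r b) e + scl (B r b') e'"
  using r_W r_perp by (intro perp_W_expansion) (auto simp: W_def)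

lemma r_b': "B r b' \<noteq> 0"
proof
  assume 0: "B r b' = 0"
  then have re: "r = scl (B r b) e"
    using r_expansion by (simp add: scl_def fun_eq_iff)
  have "B r b * B e e = 0"
    using W_e[OF r_W] by (metis re scl_left)
  then have "r = 0"
    using re e_norm by (simp add: scl_def fun_eq_iff)
  with r(2) show False by simp
qed

lemma b'_r: "B b' r \<noteq> 0"
  using r_b' by (simp add: sym)

text \<open>
  The components of \<open>y\<close> in \<open>V = W \<oplus> \<langle>b'\<rangle> \<oplus> \<langle>e\<rangle>\<close>: since \<open>r\<close> is orthogonal to \<open>W\<close> and
  \<open>e\<close>, pairing with \<open>r\<close> isolates the coefficient of \<open>b'\<close>; pairing with \<open>e\<close>, which is
  orthogonal to \<open>W\<close> and \<open>b'\<close>, isolates that of \<open>e\<close>.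
\<close>

definition cb where "cb y = B y r / B b' r"
definition ce where "ce y = B y e / B e e"
definition prW where "prW y = y - scl (cb y) b' - scl (ce y) e"

lemma decomposition: "y = prW y + scl (cb y) b' + scl (ce y) e"
  by (simp add: prW_def)

lemma prW_in_W:
  assumes "y \<in> V"
  shows "prW y \<in> W"
proof -
  have e: "B (prW y) e = 0"
    using e_norm dual by (simp add: prW_def bilinear cb_def ce_def)
  have "B (prW y) r = 0"
    using b'_r W_e[OF r_W] by (simp add: prW_def bilinear cb_def ce_def sym[of e r])
  then have "B (prW y) (scl (B r b) e + scl (B r b') e') = 0"
    using r_expansion by simp
  then have "B (prW y) e' = 0"
    using e r_b' by (simp add: bilinear)
  with e assms V show ?thesis by (simp add: W_def prW_def V_closed)
qed

lemma linear_parts: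
  "cb (x + y) = cb x + cb y" "cb (scl c x) = c * cb x"
  "ce (x + y) = ce x + ce y" "ce (scl c x) = c * ce x"
  "prW (x + y) = prW x + prW y" "prW (scl c x) = scl c (prW x)"
  by (simp_all add: cb_def ce_def prW_def bilinear add_divide_distrib)
    (simp_all add: scl_def fun_eq_iff algebra_simps add_divide_distrib)

lemma parts_W: "w \<in> W \<Longrightarrow> cb w = 0" "w \<in> W \<Longrightarrow> ce w = 0" "w \<in> W \<Longrightarrow> prW w = w"
  using r_perp by (simp_all add: prW_def cb_def ce_def W_e sym[of w r] scl_def fun_eq_iff)

lemma parts_e: "cb e = 0" "ce e = 1" "prW e = 0"
  using e_norm W_e[OF r_W] by (simp_all add: prW_def cb_def ce_def sym[of e r] scl_def fun_eq_iff)

text \<open>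
  The extension fixes \<open>e\<close> and sends \<open>b'\<close> to a vector \<open>z\<close> that has to satisfy
  \<open>z \<cdot> h w = b' \<cdot> w\<close> for \<open>w\<close> in \<open>W\<close>, \<open>z \<cdot> e = 0\<close> and \<open>z \<cdot> z = b' \<cdot> b'\<close>. The first two
  conditions are linear; a solution \<open>z\<^sub>0\<close> represents the functional that vanishes on \<open>b'\<close> and
  \<open>e\<close> and is \<open>w \<mapsto> b' \<cdot> h\<^sup>-\<^sup>1 w\<close> on \<open>W\<close>. Adding a multiple of \<open>r\<close> preserves them and
  adjusts the norm, as \<open>z\<^sub>0 \<cdot> r = b' \<cdot> r\<close> is nonzero.
\<close>

lemma isometry_extends:
  assumes h: "h \<in> orth_group_hat B W"
  obtains f where "f \<in> pointwise_stabilizer B V (perp B V W)" "restrict f W = h"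
proof -
  have ho: "h \<in> orth_group B W" and hr: "h r = r"
    using h r by (auto simp: orth_group_hat_def)
  note hD = orth_groupD[OF ho]
  obtain g where g: "g \<in> orth_group B W" and gh: "\<And>w. w \<in> W \<Longrightarrow> g (h w) = w"
    using obtain_inverse_isometry[OF subspace_W ho] by blast
  note gD = orth_groupD[OF g]
  obtain z0 where z0: "z0 \<in> V" "\<And>x. x \<in> V \<Longrightarrow> B z0 x = B b' (g (prW x))"
  proof (rule representing_vector)
    show "B b' (g (prW (x + y))) = B b' (g (prW x)) + B b' (g (prW y))"
      if "x \<in> V" "y \<in> V" for x y
      using that by (simp add: linear_parts gD(5) prW_in_W bilinear)
    show "B b' (g (prW (scl c x))) = c * B b' (g (prW x))" if "x \<in> V" for c x
      using that by (simp add: linear_parts gD(6) prW_in_W bilinear)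
  qed blast
  have z0h: "B z0 (h w) = B b' w" if "w \<in> W" for w
    using that z0(2)[of "h w"] hD(4) W_V by (simp add: parts_W gh)
  have "g 0 = 0"
    using gD(6)[OF r_W, of 0] by (simp add: scl_def zero_fun_def)
  then have z0e: "B z0 e = 0"
    using z0(2)[OF V(1)] by (simp add: parts_e)
  have z0r: "B z0 r = B b' r"
    using z0h[OF r_W] by (simp add: hr)
  \<comment> \<open>\<open>t\<close> solves \<open>z\<^sub>0 \<cdot> z\<^sub>0 + 2 t (b' \<cdot> r) = b' \<cdot> b'\<close>.\<close>
  define t where "t = (B b' b' - B z0 z0) / (2 * B b' r)"
  define z where "z = z0 + scl t r"
  have zV: "z \<in> V"
    using z0 r_V by (simp add: z_def V_closed)
  have zh: "B z (h w) = B b' w" if "w \<in> W" for w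
    using that z0h r_perp hD(4) by (simp add: z_def bilinear)
  have ze: "B z e = 0"
    using z0e W_e[OF r_W] by (simp add: z_def bilinear)
  have zz: "B z z = B b' b'"
  proof -
    have "B z z = B z0 z0 + 2 * t * B b' r"
      using z0r r_perp[OF r_W] by (simp add: z_def bilinear sym[of r z0] algebra_simps)
    also have "\<dots> = B b' b'"
      using two b'_r by (simp add: t_def field_simps)
    finally show ?thesis .
  qed
  define f where "f = (\<lambda>y\<in>V. h (prW y) + scl (cb y) z + scl (ce y) e)"
  have f: "f y = h (prW y) + scl (cb y) z + scl (ce y) e" if "y \<in> V" for y
    using that by (simp add: f_def)
  have hp: "h (prW y) \<in> W" if "y \<in> V" for y
    using that hD(4) prW_in_W by simp
  have "f \<in> orth_group B V"
  proof (rule isometryI)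
    show "f \<in> extensional V" by (simp add: f_def)
    show "f x \<in> V" if "x \<in> V" for x
      using that hp W_V zV V by (simp add: f V_closed)
    show "f (x + y) = f x + f y" if "x \<in> V" "y \<in> V" for x y
      using that
      by (simp add: f V_closed linear_parts hD(5) prW_in_W fv.scale_left_distrib)
    show "f (scl c x) = scl c (f x)" if "x \<in> V" for c x
      using that
      by (simp add: f V_closed linear_parts hD(6) prW_in_W fv.scale_right_distrib)
    show "B (f x) (f y) = B x y" if xy: "x \<in> V" "y \<in> V" for x y
    proof -
      have "B (f x) (f y) = B (prW x) (prW y) + cb y * B b' (prW x) + cb x * B b' (prW y)
          + cb x * cb y * B b' b' + ce x * ce y * B e e"
        using xy W_e[OF hp[OF xy(1)]] W_e[OF hp[OF xy(2)]]
        by (simp add: f bilinear hD(7) prW_in_W zh zz ze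
            sym[of e z] sym[of e "h _"] sym[of "h _" z] algebra_simps)
      also have "\<dots> = B (prW x + scl (cb x) b' + scl (ce x) e) (prW y + scl (cb y) b' + scl (ce y) e)"
        using W_e[OF prW_in_W[OF xy(1)]] W_e[OF prW_in_W[OF xy(2)]] dual
        by (simp add: bilinear sym[of e "prW _"] sym[of e b'] sym[of "prW x" b'] algebra_simps)
      also have "\<dots> = B x y"
        by (simp flip: decomposition)
      finally show ?thesis .
    qed
  qed
  moreover have fh: "f w = h w" if "w \<in> W" for w
    using that W_V by (simp add: f parts_W)
  moreover have fe: "f e = e"
  proof -
    have "h 0 = 0"
      using hD(6)[OF r_W, of 0] by (simp add: scl_def zero_fun_def)
    then show ?thesis using V by (simp add: f parts_e)
  qed
  moreover have "f e' = e'"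
  proof -
    have "e' = scl (1 / B r b') (r - scl (B r b) e)"
      using r_expansion r_b' by (simp add: scl_def fun_eq_iff field_simps)
    moreover have "f (r - scl (B r b) e) = r - scl (B r b) e"
    proof -
      have "f (r - scl (B r b) e) + f (scl (B r b) e) = f r"
        using orth_groupD(5)[OF \<open>f \<in> orth_group B V\<close>, of "r - scl (B r b) e" "scl (B r b) e"]
          r_V V by (simp add: V_closed)
      then show ?thesis
        using orth_groupD(6)[OF \<open>f \<in> orth_group B V\<close> V(1)] fe fh[OF r_W] hr
        by (simp add: eq_diff_eq)
    qed
    ultimately show ?thesis
      using orth_groupD(6)[OF \<open>f \<in> orth_group B V\<close>] r_V V V_closed(2,3) by metis
  qed
  ultimately have "f \<in> pointwise_stabilizer B V (perp B V W)"
    using fixes_perp_W by (simp add: pointwise_stabilizer_def)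
  moreover have "restrict f W = h"
    using fh hD(2) by (auto simp: restrict_def fun_eq_iff extensional_def)
  ultimately show thesis by (rule that)
qed

text \<open>
  The difference \<open>d\<close> of the two images of \<open>b'\<close> is orthogonal to \<open>W\<close> and \<open>e\<close>, hence a multiple
  of \<open>r\<close>. A nonzero multiple would change the norm, because \<open>b' \<cdot> r\<close> is nonzero.
\<close>

lemma isometry_extension_unique:
  assumes f: "f \<in> pointwise_stabilizer B V (perp B V W)"
    and h: "h \<in> pointwise_stabilizer B V (perp B V W)"
    and eq: "restrict f W = restrict h W"
  shows "f = h"
proof -
  have fo: "f \<in> orth_group B V" and fe: "f e = e"
    and ho: "h \<in> orth_group B V" and he: "h e = e"
    using f h e_in_perp by (auto simp: pointwise_stabilizer_def)
  note fD = orth_groupD[OF fo] and hD = orth_groupD[OF ho]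
  have fh: "f w = h w" if "w \<in> W" for w
    using fun_cong[OF eq, of w] that by simp
  have hr: "h r = r"
    using h r by (auto simp: pointwise_stabilizer_def rad_def perp_def W_def)
  define d where "d = f b' - h b'"
  have dV: "d \<in> V" using fD(4) hD(4) V by (simp add: d_def V_closed)
  have de: "B d e = 0"
    using fD(7)[OF V(4) V(1)] hD(7)[OF V(4) V(1)] by (simp add: d_def bilinear fe he)
  have "B d w = 0" if "w \<in> W" for w
  proof -
    have "w \<in> h ` W"
      using that by (simp only: stabilizes_W(2)[OF h])
    then obtain v where v: "v \<in> W" "w = h v"
      by blast
    show ?thesis
      using fD(7)[OF V(4) W_V[OF v(1)]] hD(7)[OF V(4) W_V[OF v(1)]] v fh
      by (simp add: d_def bilinear)
  qed
  then have exp: "d = scl (B d b) e + scl (B d b') e'"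
    using dV by (rule perp_W_expansion[rotated])
  \<comment> \<open>\<open>r\<close> and \<open>d\<close> both lie in the line of vectors of \<open>W\<^sup>\<bottom>\<close> orthogonal to \<open>e\<close>.\<close>
  define c where "c = B d b' / B r b'"
  have dc: "d = scl c r"
  proof -
    let ?u = "d - scl c r"
    have u: "?u = scl (B d b - c * B r b) e"
      using r_b' by (subst exp, subst r_expansion) (simp add: scl_def fun_eq_iff c_def algebra_simps)
    have "B ?u e = 0"
      using de W_e[OF r_W] by (simp add: bilinear)
    then have "B d b - c * B r b = 0"
      using e_norm unfolding u by (simp add: bilinear)
    then show ?thesis
      using u by (simp add: scl_def fun_eq_iff)
  qed
  have hbr: "B (h b') r = B b' r"
    using hD(7)[OF V(4) r_V] by (simp add: hr)
  have "B b' b' = B (h b' + scl c r) (h b' + scl c r)"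
    using fD(7)[OF V(4) V(4)] dc by (simp add: d_def diff_eq_eq add.commute)
  also have "\<dots> = B b' b' + c * (2 * B b' r)"
    using hD(7)[OF V(4) V(4)] hbr r_perp[OF r_W]
    by (simp add: bilinear sym[of r "h b'"] algebra_simps)
  finally have "c = 0" using two b'_r by simp
  then have fb': "f b' = h b'"
    using dc by (simp add: d_def scl_def fun_eq_iff)
  have "f y = h y" if y: "y \<in> V" for y
  proof -
    have mem: "prW y \<in> V" "scl (cb y) b' \<in> V" "scl (ce y) e \<in> V"
      using W_V[OF prW_in_W[OF y]] V by (auto simp: V_closed)
    have "f (prW y + scl (cb y) b' + scl (ce y) e) = h (prW y + scl (cb y) b' + scl (ce y) e)"
      using mem V fb' fe he fh[OF prW_in_W[OF y]]
      by (simp add: V_closed fD(5,6) hD(5,6))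
    then show ?thesis by (simp flip: decomposition)
  qed
  then show ?thesis
    by (rule extensionalityI[OF fD(2) hD(2)])
qed

lemma iso_restrict:
  "(\<lambda>f. restrict f W) \<in> iso stabW ((BijGroup W)\<lparr>carrier := orth_group_hat B W\<rparr>)"
proof -
  have "bij_betw (\<lambda>f. restrict f W) (pointwise_stabilizer B V (perp B V W)) (orth_group_hat B W)"
    unfolding bij_betw_def inj_on_def
    using isometry_extension_unique restrict_in_orth_group_hat
    by (auto simp: image_iff) (metis isometry_extends)
  then show ?thesis
    using restrict_in_orth_group_hat restrict_compose by (auto simp: iso_def hom_def)
qed

end


section \<open>Reduction of a basic system\<close>

lemma symmetric_form_gram_form:
  assumes "\<And>i j. i < n \<Longrightarrow> j < n \<Longrightarrow> g i j = g j i"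
  shows "symmetric_form (gram_form n g)"
proof
  fix x y z :: "nat \<Rightarrow> 'a" and c
  show "gram_form n g (x + y) z = gram_form n g x z + gram_form n g y z"
    by (simp add: gram_form_def algebra_simps sum.distrib)
  show "gram_form n g (scl c x) z = c * gram_form n g x z"
    by (simp add: gram_form_def scl_def sum_distrib_left mult.assoc)
  have "gram_form n g x y = (\<Sum>i<n. \<Sum>j<n. x j * g j i * y i)"
    unfolding gram_form_def by (rule sum.swap)
  also have "\<dots> = gram_form n g y x"
    unfolding gram_form_def using assms by (intro sum.cong refl) (simp add: mult_ac)
  finally show "gram_form n g x y = gram_form n g y x" .
qed

lemma gram_form_std_basis_right:
  assumes "j < n"
  shows "gram_form n g x (std_basis j) = (\<Sum>i<n. x i * g i j)"
proof -
  have "gram_form n g x (std_basis j) = (\<Sum>i<n. \<Sum>k<n. if k = j then x i * g i k else 0)"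
    unfolding gram_form_def by (intro sum.cong refl) (simp add: std_basis_def)
  then show ?thesis using assms by simp
qed

lemma gram_form_std_basis:
  assumes "i < n" "j < n"
  shows "gram_form n g (std_basis i) (std_basis j) = g i j"
proof -
  have "gram_form n g (std_basis i) (std_basis j) = (\<Sum>k<n. if k = i then g k j else 0)"
    unfolding gram_form_std_basis_right[OF assms(2)] by (intro sum.cong refl) (simp add: std_basis_def)
  then show ?thesis using assms by simp
qed

lemma reduced_space_coordinates:
  "(reduced_space n J :: (nat \<Rightarrow> 'p::prime_card mod_ring) set)
    = {x \<in> coord_space n. \<forall>j\<in>J. x j = 0}" (is "?L = ?R")
proof
  have "fv.subspace ?R"
    by (auto simp: fv.subspace_def coord_space_def scl_def)
  then show "?L \<subseteq> ?R"
    unfolding reduced_space_def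
    by (rule fv.span_minimal[rotated]) (auto simp: std_basis_def coord_space_def)
  show "?R \<subseteq> ?L"
  proof
    fix x assume "x \<in> ?R"
    then have x: "x \<in> coord_space n" "\<forall>j\<in>J. x j = 0" by auto
    have "scl (x i) (std_basis i) \<in> reduced_space n J" if "i < n" for i
    proof (cases "i \<in> J")
      case True
      then have "scl (x i) (std_basis i) = 0" using x by (simp add: scl_def fun_eq_iff)
      then show ?thesis unfolding reduced_space_def by (simp only: fv.span_zero)
    next
      case False
      then show ?thesis
        using that unfolding reduced_space_def by (intro fv.span_scale fv.span_base) auto
    qed
    then have "(\<Sum>i<n. scl (x i) (std_basis i)) \<in> reduced_space n J"
      unfolding reduced_space_def by (intro fv.span_sum) auto
    then show "x \<in> reduced_space n J"
      using coord_space_expansion[OF x(1)] by simp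
  qed
qed

text \<open>
  A generic prime dividing a label could only be \<open>3\<close>; but a label is divisible by \<open>3\<close> only in the
  presence of a branch marked \<open>6\<close>, in which case \<open>3\<close> is not generic.
\<close>

lemma label_nonzero:
  assumes lab: "admissible_labels n m g" and gen: "generic_prime n m CARD('p::prime_card)"
    and i: "i < n"
  obtains d :: nat where "g i i = real d" "(of_nat d :: 'p mod_ring) \<noteq> 0"
proof -
  obtain d :: nat where d: "d > 0" "g i i = real d" "\<And>q. prime q \<Longrightarrow> q dvd d \<Longrightarrow> q \<in> {2, 3}"
    "3 dvd d \<Longrightarrow> \<exists>k\<in>{1..<n}. m k = 6"
    using lab i unfolding admissible_labels_def by blast
  have "\<not> CARD('p) dvd d"
  proof
    assume dvd: "CARD('p) dvd d"
    then have "CARD('p) \<in> {2, 3}"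
      using gen d(3) by (simp add: generic_prime_def)
    then have "CARD('p) = 3" "\<forall>k\<in>{1..<n}. m k \<noteq> 6"
      using gen by (auto simp: generic_prime_def)
    then show False using d(4) dvd by auto
  qed
  then have "(of_nat d :: 'p mod_ring) \<noteq> 0"
    using of_nat_0_mod_ring_dvd by blast
  with d(2) show thesis by (rule that)
qed

lemma two_nonzero:
  assumes "generic_prime n m CARD('p::prime_card)"
  shows "(2 :: 'p mod_ring) \<noteq> 0"
proof
  assume "(2 :: 'p mod_ring) = 0"
  then have "CARD('p) dvd 2"
    using of_nat_0_mod_ring_dvd[of 2, where 'a = 'p] by simp
  then show False
    using assms by (auto simp: generic_prime_def dest: dvd_imp_le)
qed

text \<open>
  The reduction of the matrix of \<open>r\<^sub>i\<close> is again a reflection because \<open>2 b\<^sub>j \<cdot> b\<^sub>i\<close> is the integer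
  \<open>2 (b\<^sub>j \<cdot> b\<^sub>i) / (b\<^sub>i \<cdot> b\<^sub>i)\<close> times the label of \<open>i\<close>, and this label is invertible modulo
  \<open>p\<close>.
\<close>

lemma reduced_reflection_eq_reflection:
  fixes B :: "'p::prime_card mod_ring form"
  assumes bas: "basic_system n m g" and lab: "admissible_labels n m g"
    and gen: "generic_prime n m CARD('p)" and B: "B = reduced_form n g" and i: "i < n"
  shows "B (std_basis i) (std_basis i) = reduced_label g i"
    and "B (std_basis i) (std_basis i) \<noteq> 0"
    and "reduced_reflection n g i = reflection B (coord_space n) (std_basis i)"
proof -
  have two: "(2 :: 'p mod_ring) \<noteq> 0" by (rule two_nonzero[OF gen])
  obtain d :: nat where d: "g i i = real d" "(of_nat d :: 'p mod_ring) \<noteq> 0"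
    using label_nonzero[OF lab gen i] .
  have "\<lfloor>2 * g i i\<rfloor> = 2 * int d"
    unfolding d(1) by (metis floor_of_int of_int_mult of_int_numeral of_int_of_nat_eq)
  then have norm: "B (std_basis i) (std_basis i) = of_nat d"
    using two i by (simp add: B reduced_form_def gram_form_std_basis reduced_gram_def)
  then show "B (std_basis i) (std_basis i) = reduced_label g i"
    and "B (std_basis i) (std_basis i) \<noteq> 0"
    using d by (simp_all add: reduced_label_def)
  have cartan: "\<exists>c::int. 2 * g j i = of_int c * real d" if j: "j < n" for j
  proof -
    have "2 * g i j / g i i \<in> \<int>" "g i j = g j i" "g i i > 0"
      using bas i j by (auto simp: basic_system_def)
    then show ?thesis
      using d(1) by (auto elim!: Ints_cases simp: field_simps)
  qed
  \<comment> \<open>\<open>c j\<close> is the Cartan integer \<open>2 (b\<^sub>j \<cdot> b\<^sub>i) / (b\<^sub>i \<cdot> b\<^sub>i)\<close>.\<close>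
  then obtain c where c: "\<And>j. j < n \<Longrightarrow> 2 * g j i = of_int (c j) * real d"
    by metis
  have d0: "d \<noteq> 0" using d(2) by (cases d) simp_all
  have mat: "\<lfloor>root_reflection_matrix n g i k j\<rfloor>
      = (if k = j then 1 else 0) - (if k = i then c j else 0)" if "j < n" "k < n" for j k
  proof -
    have "root_reflection_matrix n g i k j = std_basis j k - (2 * g j i / g i i) * std_basis i k"
      using that i by (simp add: root_reflection_matrix_def reflection_def scl_def
          std_basis_in_coord_space gram_form_std_basis)
    also have "\<dots> = of_int ((if k = j then 1 else 0) - (if k = i then c j else 0))"
      using c[OF that(1)] d(1) d0 by (simp add: std_basis_def)
    finally show ?thesis by (simp only: floor_of_int)
  qed
  have gram: "2 * reduced_gram g j i = of_int (c j) * (of_nat d :: 'p mod_ring)" if "j < n" for j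
  proof -
    have "\<lfloor>2 * g j i\<rfloor> = c j * int d"
      using c[OF that] by (metis floor_of_int of_int_mult of_int_of_nat_eq)
    then show ?thesis using two by (simp add: reduced_gram_def)
  qed
  show "reduced_reflection n g i = reflection B (coord_space n) (std_basis i)"
  proof
    fix x :: "nat \<Rightarrow> 'p mod_ring"
    show "reduced_reflection n g i x = reflection B (coord_space n) (std_basis i) x"
    proof (cases "x \<in> coord_space n")
      case x: True
      have "2 * B x (std_basis i) = (\<Sum>j<n. x j * (2 * reduced_gram g j i))"
        using i by (simp add: B reduced_form_def gram_form_std_basis_right sum_distrib_left mult_ac)
      also have "\<dots> = (\<Sum>j<n. of_int (c j) * x j) * of_nat d"
        unfolding sum_distrib_right by (intro sum.cong refl) (simp add: gram mult_ac)
      finally have coef: "2 * B x (std_basis i) / B (std_basis i) (std_basis i)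
          = (\<Sum>j<n. of_int (c j) * x j)"
        using norm d(2) by simp
      have "reduced_reflection n g i x k = reflection B (coord_space n) (std_basis i) x k" for k
      proof (cases "k < n")
        case k: True
        have "(\<Sum>j<n. of_int \<lfloor>root_reflection_matrix n g i k j\<rfloor> * x j)
            = (\<Sum>j<n. (if k = j then x j else 0) - (if k = i then of_int (c j) * x j else 0))"
          using k by (intro sum.cong refl) (simp add: mat left_diff_distrib)
        also have "\<dots> = x k - (if k = i then \<Sum>j<n. of_int (c j) * x j else 0)"
          using k by (simp add: sum_subtractf)
        finally show ?thesis
          using x k by (simp add: reduced_reflection_def reflection_def coef scl_def std_basis_apply)
      next
        case False
        then show ?thesis
          using x i by (simp add: reduced_reflection_def reflection_def scl_def std_basis_def coord_space_def)
      qed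
      then show ?thesis by (rule ext)
    qed (simp add: reduced_reflection_def reflection_def)
  qed
qed

theorem theorem3p3:
  fixes n :: nat and m :: "nat \<Rightarrow> enat" and g :: "nat \<Rightarrow> nat \<Rightarrow> real"
    and B :: "'p::prime_card mod_ring form"
    and V V0 Vl W :: "(nat \<Rightarrow> 'p mod_ring) set"
    and G0 Gl :: "'p mod_ring trafo set"
  assumes "basic_system n m g" and "admissible_labels n m g"
    and "generic_prime n m CARD('p)"
    and "B = reduced_form n g" and "V = coord_space n"
    and "V0 = reduced_space n {0}" and "Vl = reduced_space n {n - 1}"
    and "W = reduced_space n {0, n - 1}"
    and "G0 = reduced_group n g {0}" and "Gl = reduced_group n g {n - 1}"
    and "nonsingular B V" and "nonsingular B V0" and "nonsingular B Vl"
    and "\<not> nonsingular B W"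
    and "orthogonal_type B V0 (restrict_group V0 G0)"
    and "orthogonal_type B Vl (restrict_group Vl Gl)"
    and "\<exists>i\<in>{1..n - 2}. is_square (reduced_label g i :: 'p mod_ring)"
  shows
    \<comment> \<open>the two identifications, via restriction to \<open>W\<close>\<close>
    "((\<lambda>f. restrict f W) \<in>
        iso ((BijGroup V)\<lparr>carrier := pointwise_stabilizer B V (perp B V W)\<rparr>)
            ((BijGroup W)\<lparr>carrier := orth_group_hat B W\<rparr>) \<and>
      square_refl_group B V W \<subseteq> orth_group1 B V \<inter> pointwise_stabilizer B V (perp B V W) \<and>
      restrict_group W (square_refl_group B V W) = orth_group_hat1 B W) \<and>
     \<comment> \<open>part (a)\<close>
     ((\<forall>f\<in>G0 \<inter> Gl. \<forall>x\<in>perp B V W. f x = x) \<and>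
      square_refl_group B V W \<subseteq> G0 \<inter> Gl \<and>
      G0 \<inter> Gl \<subseteq> pointwise_stabilizer B V (perp B V W)) \<and>
     \<comment> \<open>part (b)\<close>
     (G0 = pointwise_stabilizer B V (perp B V V0) \<and>
      Gl = pointwise_stabilizer B V (perp B V Vl) \<longrightarrow>
      pointwise_stabilizer B V (perp B V W) = G0 \<inter> Gl)"
proof -
  note bas = assms(1) and lab = assms(2) and gen = assms(3) and B = assms(4)
  have two: "(2 :: 'p mod_ring) \<noteq> 0" by (rule two_nonzero[OF gen])
  obtain i where i: "i \<in> {1..n - 2}" and sq: "is_square (reduced_label g i :: 'p mod_ring)"
    using assms(17) by blast
  have lt: "i < n" "0 < n" "n - 1 < n" "i \<noteq> 0" "i \<noteq> n - 1" "n - 1 \<noteq> 0" using i by auto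
  have "reduced_gram g i j = (reduced_gram g j i :: 'p mod_ring)" if "i < n" "j < n" for i j
    using bas that unfolding basic_system_def reduced_gram_def by metis
  then interpret symmetric_form B
    unfolding B reduced_form_def by (intro symmetric_form_gram_form)
  interpret nonsingular_space B n
    by unfold_locales (use assms in simp)
  have VV: "V = coord_space n" by (rule assms(5))
  have dual_vector: "\<exists>e\<in>V. \<forall>x\<in>V. B x e = x j" for j
  proof -
    obtain z where "z \<in> V" "\<And>x. x \<in> V \<Longrightarrow> B z x = x j"
      using representing_vector[of "\<lambda>x. x j"] VV by (auto simp: scl_def)
    then show ?thesis using sym by metis
  qed
  \<comment> \<open>The nodes \<open>0\<close> and \<open>n - 1\<close> are treated alike; the square label is at an inner node \<open>i\<close>, so
    the root \<open>b\<^sub>i\<close> lies in both hyperplanes and its reflection in both groups.\<close>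
  have hyperplane: "\<exists>e. e \<in> V \<and> (\<forall>x\<in>V. B x e = x j) \<and> B e e \<noteq> 0
      \<and> perp B V (reduced_space n {j}) \<subseteq> perp B V W
      \<and> reduced_group n g {j} \<subseteq> pointwise_stabilizer B V {e}
      \<and> square_refl_group B V W \<subseteq> reduced_group n g {j}"
    if j: "j = 0 \<or> j = n - 1" for j
  proof -
    obtain e where e: "e \<in> V" "\<And>x. x \<in> V \<Longrightarrow> B x e = x j"
      using dual_vector[of j] by blast
    have U: "reduced_space n {j} = {x \<in> V. B x e = 0}"
      by (auto simp: reduced_space_coordinates VV e(2)[unfolded VV])
    have nonsingU: "nonsingular B (reduced_space n {j})"
      using j assms(6,7,12,13) by auto
    have ee: "B e e \<noteq> 0"
    proof
      assume "B e e = 0"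
      moreover have "B e y = 0" if "B y e = 0" for y
        using that sym[of e y] by simp
      ultimately have "e \<in> rad B (reduced_space n {j})"
        using e(1) by (simp add: U rad_def perp_def)
      then have "e = 0" using nonsingU by (simp add: nonsingular_def)
      then have "std_basis j j = (0 :: 'p mod_ring)"
        using e(2)[of "std_basis j"] j lt by (auto simp: VV std_basis_in_coord_space)
      then show False by (simp add: std_basis_def)
    qed
    have WU: "W \<subseteq> reduced_space n {j}"
      using j by (auto simp: assms(8) reduced_space_coordinates)
    interpret Bij: group "BijGroup V" by (rule group_BijGroup)
    let ?R = "{reduced_reflection n g k |k. k < n \<and> k \<notin> {j}} :: 'p mod_ring trafo set"
    have stab: "subgroup (pointwise_stabilizer B V {e}) (BijGroup V)"
      using e(1) by (intro subgroup_pointwise_stabilizer) (auto simp: VV subspace_coord_space)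
    have "?R \<subseteq> pointwise_stabilizer B V {e}"
    proof
      fix f assume "f \<in> ?R"
      then obtain k where f: "f = reduced_reflection n g k" and k: "k < n" "k \<noteq> j" by auto
      have kV: "std_basis k \<in> V" using k by (simp add: VV std_basis_in_coord_space)
      have "reflection B V (std_basis k) \<in> orth_group B V"
        using kV unfolding VV by (intro reflection_in_orth_group subspace_coord_space)
      moreover have "std_basis k j = (0 :: 'p mod_ring)"
        using k by (simp add: std_basis_def)
      then have "reflection B V (std_basis k) e = e"
        using e(2)[OF kV] sym[of e "std_basis k"] by (intro reflection_fixes e(1)) simp
      ultimately show "f \<in> pointwise_stabilizer B V {e}"
        using reduced_reflection_eq_reflection(3)[OF bas lab gen B k(1)]
        by (simp add: pointwise_stabilizer_def f VV)
    qed
    then have G: "reduced_group n g {j} \<subseteq> pointwise_stabilizer B V {e}"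
      and R: "?R \<subseteq> carrier (BijGroup V)"
      using Bij.generate_subgroup_incl[OF _ stab] subgroup.subset[OF stab]
      by (auto simp: reduced_group_def VV)
    have sub: "subgroup (reduced_group n g {j}) (BijGroup V)"
      using Bij.generate_is_subgroup[OF R] by (simp add: reduced_group_def VV)
    have bi: "std_basis i \<in> reduced_space n {j}"
      using lt j by (auto simp: reduced_space_coordinates std_basis_in_coord_space std_basis_apply)
    have "reflection B V (std_basis i) \<in> reduced_group n g {j}"
      unfolding reduced_group_def VV reduced_reflection_eq_reflection(3)[OF bas lab gen B lt(1), symmetric]
      using lt j by (intro generate.incl) auto
    moreover have "orthogonal_type B (reduced_space n {j}) (restrict_group (reduced_space n {j}) (reduced_group n g {j}))"
      using j assms(6,7,9,10,15,16) by auto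
    ultimately have "square_refl_group B V W \<subseteq> reduced_group n g {j}"
      using square_refl_group_le[OF two e(1)[unfolded VV] ee U[unfolded VV] G[unfolded VV] sub[unfolded VV] _ bi
          _ reduced_reflection_eq_reflection(2)[OF bas lab gen B lt(1)] _ WU] sq
        reduced_reflection_eq_reflection(1)[OF bas lab gen B lt(1)]
      by (simp add: VV)
    moreover have "perp B V (reduced_space n {j}) \<subseteq> perp B V W"
      using WU by (auto simp: perp_def)
    ultimately show ?thesis
      using e ee U G by blast
  qed
  obtain e where e: "e \<in> V" "\<forall>x\<in>V. B x e = x 0" "B e e \<noteq> 0" "perp B V V0 \<subseteq> perp B V W"
      "G0 \<subseteq> pointwise_stabilizer B V {e}" "square_refl_group B V W \<subseteq> G0"
    using hyperplane[of 0] assms(6,9) by auto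
  obtain e' where e': "e' \<in> V" "\<forall>x\<in>V. B x e' = x (n - 1)" "perp B V Vl \<subseteq> perp B V W"
      "Gl \<subseteq> pointwise_stabilizer B V {e'}" "square_refl_group B V W \<subseteq> Gl"
    using hyperplane[of "n - 1"] assms(7,10) by auto
  interpret P: hyperplane_pair B n e e' "std_basis 0" "std_basis (n - 1)"
    using e(1,2) e'(1,2) lt
    by unfold_locales (auto simp: VV std_basis_in_coord_space std_basis_apply)
  have W: "P.W = W"
    using e(2) e'(2) by (auto simp: P.W_def assms(8) reduced_space_coordinates VV)
  obtain r where r: "r \<in> rad B W" "r \<noteq> 0"
  proof -
    have "0 \<in> rad B W"
      using fv.subspace_0[OF P.subspace_W] by (auto simp: W rad_def perp_def)
    then show thesis using assms(14) that by (auto simp: nonsingular_def)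
  qed
  interpret S: singular_hyperplane_pair B n e e' "std_basis 0" "std_basis (n - 1)" r
    using two e(3) r by unfold_locales (simp_all add: W)
  have fixes_perp: "f \<in> pointwise_stabilizer B V (perp B V W)" if "f \<in> G0 \<inter> Gl" for f
  proof -
    have f: "f \<in> orth_group B V" "f e = e" "f e' = e'"
      using that e(5) e'(4) by (auto simp: pointwise_stabilizer_def)
    then show ?thesis
      using P.fixes_perp_W[of f] by (auto simp: pointwise_stabilizer_def W VV)
  qed
  have fixed: "\<forall>f\<in>G0 \<inter> Gl. \<forall>x\<in>perp B V W. f x = x"
  proof (intro ballI)
    fix f x assume "f \<in> G0 \<inter> Gl" "x \<in> perp B V W"
    then show "f x = x"
      using fixes_perp[of f] by (simp add: pointwise_stabilizer_def)
  qed
  have le_stab: "G0 \<inter> Gl \<subseteq> pointwise_stabilizer B V (perp B V W)"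
    using fixes_perp by (rule subsetI)
  have "pointwise_stabilizer B V (perp B V W) \<subseteq> pointwise_stabilizer B V (perp B V V0)"
    "pointwise_stabilizer B V (perp B V W) \<subseteq> pointwise_stabilizer B V (perp B V Vl)"
    using e(4) e'(3) unfolding pointwise_stabilizer_def by blast+
  then have part_b: "G0 = pointwise_stabilizer B V (perp B V V0) \<and>
      Gl = pointwise_stabilizer B V (perp B V Vl) \<longrightarrow>
      pointwise_stabilizer B V (perp B V W) = G0 \<inter> Gl"
    using le_stab by (intro impI subset_antisym) simp_all
  show ?thesis
    by (intro conjI Int_greatest fixed le_stab part_b e(6) e'(5)
        S.iso_restrict[unfolded W VV[symmetric]]
        P.square_refl_group_le_orth_group1[unfolded W VV[symmetric]]
        P.square_refl_group_le_pointwise_stabilizer[unfolded W VV[symmetric]]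
        P.restrict_square_refl_group[unfolded W VV[symmetric]])
qed

end
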